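(* There is a polynomial time $3$-approximation algorithm for the knapsack-and-matroid center problem.
   Context: Knapsack-and-matroid center problem: given a finite metric space $(X,d)$, a matroid $\mathcal{M}$ on ground set $X$ with independent sets $\mathscr{I}_{\mathcal{M}}$, a weight function $w:X\to\mathbb{R}_{\ge0}$ and a budget $k$, find $S\subseteq X$ with $S\in\mathscr{I}_{\mathcal{M}}$ and $\sum_{v\in S}w(v)\le k$ minimizing $\max_{v\in X}d(v,S)$, where $d(v,S)=\min_{u\in S}d(v,u)$. A $3$-approximation returns such a feasible $S$ with $\max_{v\in X}d(v,S)\le 3\,\mathrm{OPT}$, where $\mathrm{OPT}$ is the optimum value. (No outliers are allowed: every point must be served.) *)

theory Defs
  imports
    "HOL-Analysis.Abstract_Metric_Spaces"
    "HOL-Computational_Algebra.Polynomial"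
begin

section \<open>The knapsack-and-matroid center problem\<close>

locale matroid =
  fixes E :: "'a set" and \<I> :: "'a set set"
  assumes finite_ground: "finite E"
    and indep_subset_ground: "A \<in> \<I> \<Longrightarrow> A \<subseteq> E"
    and empty_indep: "{} \<in> \<I>"
    and indep_subset: "A \<in> \<I> \<Longrightarrow> B \<subseteq> A \<Longrightarrow> B \<in> \<I>"
    and exchange: "A \<in> \<I> \<Longrightarrow> B \<in> \<I> \<Longrightarrow> card A < card B \<Longrightarrow> \<exists>x \<in> B - A. insert x A \<in> \<I>"

locale knapsack_matroid_instance = Metric_space X d + matroid X \<I>
  for X :: "'a set" and d :: "'a \<Rightarrow> 'a \<Rightarrow> real" and \<I> :: "'a set set" +
  fixes w :: "'a \<Rightarrow> real"
  assumes nonempty: "X \<noteq> {}"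
    and weight_nonneg: "v \<in> X \<Longrightarrow> 0 \<le> w v"

definition set_distance :: "('a \<Rightarrow> 'a \<Rightarrow> real) \<Rightarrow> 'a \<Rightarrow> 'a set \<Rightarrow> real" where
  "set_distance d v S = Min ((\<lambda>u. d v u) ` S)"

definition center_cost :: "'a set \<Rightarrow> ('a \<Rightarrow> 'a \<Rightarrow> real) \<Rightarrow> 'a set \<Rightarrow> real" where
  "center_cost X d S = Max ((\<lambda>v. set_distance d v S) ` X)"

text \<open>The minimum in \<^const>\<open>set_distance\<close> is over a nonempty set only when \<open>S \<noteq> {}\<close>, so the
  empty set, which serves no point, is not a solution.\<close>

definition feasible :: "'a set set \<Rightarrow> ('a \<Rightarrow> real) \<Rightarrow> real \<Rightarrow> 'a set \<Rightarrow> bool" where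
  "feasible \<I> w k S \<longleftrightarrow> S \<noteq> {} \<and> S \<in> \<I> \<and> (\<Sum>v\<in>S. w v) \<le> k"

definition opt_cost ::
  "'a set \<Rightarrow> ('a \<Rightarrow> 'a \<Rightarrow> real) \<Rightarrow> 'a set set \<Rightarrow> ('a \<Rightarrow> real) \<Rightarrow> real \<Rightarrow> real" where
  "opt_cost X d \<I> w k = Min (center_cost X d ` {S. feasible \<I> w k S})"

section \<open>The model of computation\<close>

text \<open>
  Algorithms are programs of a while language over a random access memory with two sorts of cells,
  holding natural numbers and real numbers. A cell is addressed by a variable name and a list of
  indices (\<open>[]\<close> for a scalar, \<open>[i]\<close> and \<open>[i, j]\<close> for one- and two-dimensional arrays). The matroid
  is accessed only through an independence oracle.

  Every executed assignment, test and skip costs one unit; this includes oracle queries. The size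
  of an expression is a constant of the program. Arithmetic is restricted to addition and
  subtraction, and the constants of a program are natural and rational numbers: unit-cost
  multiplication or arbitrary real constants would make the model unreasonably powerful. With this
  restriction, on rational data, all intermediate numbers of a computation of polynomial cost have
  polynomial bit length.
\<close>

type_synonym vname = string

datatype nexp =
    NConst nat
  | NRead vname "nexp list"
  | NPlus nexp nexp
  | NMinus nexp nexp

datatype rexp =
    RConst rat
  | RRead vname "nexp list"
  | RPlus rexp rexp
  | RMinus rexp rexp

datatype bexp =
    NLess nexp nexp
  | RLess rexp rexp
  | Indep vname
  | BNot bexp
  | BAnd bexp bexp

datatype com =
    Skip
  | NAssign vname "nexp list" nexp
  | RAssign vname "nexp list" rexp
  | Seq com com
  | Cond bexp com com
  | While bexp com

record state =
  nats :: "vname \<Rightarrow> nat list \<Rightarrow> nat"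
  reals :: "vname \<Rightarrow> nat list \<Rightarrow> real"

fun nval :: "nexp \<Rightarrow> state \<Rightarrow> nat" where
  "nval (NConst c) s = c"
| "nval (NRead x es) s = nats s x (map (\<lambda>e. nval e s) es)"
| "nval (NPlus a b) s = nval a s + nval b s"
| "nval (NMinus a b) s = nval a s - nval b s"

fun rval :: "rexp \<Rightarrow> state \<Rightarrow> real" where
  "rval (RConst c) s = of_rat c"
| "rval (RRead x es) s = reals s x (map (\<lambda>e. nval e s) es)"
| "rval (RPlus a b) s = rval a s + rval b s"
| "rval (RMinus a b) s = rval a s - rval b s"

text \<open>A set of points is represented by a one-dimensional array that is nonzero exactly at the
  members of the set; the oracle is queried on such an array.\<close>

definition represented_set :: "state \<Rightarrow> vname \<Rightarrow> nat set" where
  "represented_set s x = {i. nats s x [i] \<noteq> 0}"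

fun bval :: "nat set set \<Rightarrow> bexp \<Rightarrow> state \<Rightarrow> bool" where
  "bval \<I> (NLess a b) s \<longleftrightarrow> nval a s < nval b s"
| "bval \<I> (RLess a b) s \<longleftrightarrow> rval a s < rval b s"
| "bval \<I> (Indep x) s \<longleftrightarrow> represented_set s x \<in> \<I>"
| "bval \<I> (BNot b) s \<longleftrightarrow> \<not> bval \<I> b s"
| "bval \<I> (BAnd b c) s \<longleftrightarrow> bval \<I> b s \<and> bval \<I> c s"

definition nat_update :: "vname \<Rightarrow> nat list \<Rightarrow> nat \<Rightarrow> state \<Rightarrow> state" where
  "nat_update x is a s = s\<lparr>nats := (nats s)(x := (nats s x)(is := a))\<rparr>"

definition real_update :: "vname \<Rightarrow> nat list \<Rightarrow> real \<Rightarrow> state \<Rightarrow> state" where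
  "real_update x is a s = s\<lparr>reals := (reals s)(x := (reals s x)(is := a))\<rparr>"

text \<open>\<open>exec \<I> c s t s'\<close>: with independence oracle \<open>\<I>\<close>, the program \<open>c\<close> started in \<open>s\<close> halts
  in \<open>s'\<close> at cost \<open>t\<close>.\<close>

inductive exec :: "nat set set \<Rightarrow> com \<Rightarrow> state \<Rightarrow> nat \<Rightarrow> state \<Rightarrow> bool" for \<I> where
  Skip: "exec \<I> Skip s 1 s"
| NAssign: "exec \<I> (NAssign x es e) s 1 (nat_update x (map (\<lambda>e. nval e s) es) (nval e s) s)"
| RAssign: "exec \<I> (RAssign x es e) s 1 (real_update x (map (\<lambda>e. nval e s) es) (rval e s) s)"
| Seq: "exec \<I> c1 s t1 s' \<Longrightarrow> exec \<I> c2 s' t2 s'' \<Longrightarrow> exec \<I> (Seq c1 c2) s (t1 + t2) s''"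
| CondTrue: "bval \<I> b s \<Longrightarrow> exec \<I> c1 s t s' \<Longrightarrow> exec \<I> (Cond b c1 c2) s (t + 1) s'"
| CondFalse: "\<not> bval \<I> b s \<Longrightarrow> exec \<I> c2 s t s' \<Longrightarrow> exec \<I> (Cond b c1 c2) s (t + 1) s'"
| WhileFalse: "\<not> bval \<I> b s \<Longrightarrow> exec \<I> (While b c) s 1 s"
| WhileTrue: "bval \<I> b s \<Longrightarrow> exec \<I> c s t1 s' \<Longrightarrow> exec \<I> (While b c) s' t2 s'' \<Longrightarrow>
    exec \<I> (While b c) s (t1 + t2 + 1) s''"

inductive_cases exec_SkipE: "exec \<I> Skip s t s'"
inductive_cases exec_NAssignE: "exec \<I> (NAssign x es e) s t s'"
inductive_cases exec_RAssignE: "exec \<I> (RAssign x es e) s t s'"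
inductive_cases exec_SeqE: "exec \<I> (Seq c1 c2) s t s'"
inductive_cases exec_CondE: "exec \<I> (Cond b c1 c2) s t s'"
inductive_cases exec_WhileE: "exec \<I> (While b c) s t s'"

lemma exec_deterministic:
  "exec \<I> c s t s' \<Longrightarrow> exec \<I> c s u s'' \<Longrightarrow> u = t \<and> s'' = s'"
proof (induction arbitrary: u s'' rule: exec.induct)
  case (Skip s)
  then show ?case by (auto elim: exec_SkipE)
next
  case (NAssign x es e s)
  then show ?case by (auto elim: exec_NAssignE)
next
  case (RAssign x es e s)
  then show ?case by (auto elim: exec_RAssignE)
next
  case (Seq c1 s t1 s1 c2 t2 s2)
  from Seq.prems obtain v1 r v2 where "exec \<I> c1 s v1 r" "exec \<I> c2 r v2 s''" "u = v1 + v2"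
    by (rule exec_SeqE)
  with Seq.IH show ?case by metis
next
  case (CondTrue b s c1 t s1 c2)
  from CondTrue.prems CondTrue.hyps obtain v where "exec \<I> c1 s v s''" "u = v + 1"
    by (auto elim: exec_CondE)
  with CondTrue.IH show ?case by metis
next
  case (CondFalse b s c2 t s1 c1)
  from CondFalse.prems CondFalse.hyps obtain v where "exec \<I> c2 s v s''" "u = v + 1"
    by (auto elim: exec_CondE)
  with CondFalse.IH show ?case by metis
next
  case (WhileFalse b s c)
  from WhileFalse.prems WhileFalse.hyps show ?case by (auto elim: exec_WhileE)
next
  case (WhileTrue b s c t1 s1 t2 s2)
  from WhileTrue.prems WhileTrue.hyps(1) obtain v1 r v2
    where "exec \<I> c s v1 r" "exec \<I> (While b c) r v2 s''" "u = v1 + v2 + 1"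
    by (auto elim: exec_WhileE)
  with WhileTrue.IH show ?case by metis
qed

section \<open>Polynomial time approximation algorithms for the problem\<close>

text \<open>The points of an instance with \<open>n\<close> points are numbered \<open>0, \<dots>, n - 1\<close>. Everything outside
  the input is initially zero.\<close>

definition input_state ::
  "nat \<Rightarrow> (nat \<Rightarrow> nat \<Rightarrow> real) \<Rightarrow> (nat \<Rightarrow> real) \<Rightarrow> real \<Rightarrow> state" where
  "input_state n d w k =
    \<lparr>nats = (\<lambda>x is. if x = ''n'' \<and> is = [] then n else 0),
     reals = (\<lambda>x is. case is of
         [] \<Rightarrow> if x = ''k'' then k else 0
       | [i] \<Rightarrow> if x = ''w'' \<and> i < n then w i else 0
       | [i, j] \<Rightarrow> if x = ''d'' \<and> i < n \<and> j < n then d i j else 0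
       | _ \<Rightarrow> 0)\<rparr>"

definition output_set :: "state \<Rightarrow> nat set" where
  "output_set s = represented_set s ''S''"

definition polynomial_time :: "com \<Rightarrow> bool" where
  "polynomial_time A \<longleftrightarrow>
    (\<exists>p :: nat poly. \<forall>n d \<I> w k. knapsack_matroid_instance {..<n} d \<I> w \<longrightarrow>
      (\<exists>t s. exec \<I> A (input_state n d w k) t s \<and> t \<le> poly p n))"

text \<open>If an instance has no solution at all, an algorithm has to report this, by the output
  \<open>{}\<close>.\<close>

definition approximation_algorithm :: "real \<Rightarrow> com \<Rightarrow> bool" where
  "approximation_algorithm \<alpha> A \<longleftrightarrow>
    (\<forall>n d \<I> w k. knapsack_matroid_instance {..<n} d \<I> w \<longrightarrow>
      (\<exists>t s. exec \<I> A (input_state n d w k) t s \<and>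
        (if \<exists>S. feasible \<I> w k S
         then feasible \<I> w k (output_set s) \<and>
              center_cost {..<n} d (output_set s) \<le> \<alpha> * opt_cost {..<n} d \<I> w k
         else output_set s = {})))"

end

theory Submission
  imports Defs
begin

text \<open>
  The optimum is one of the distances \<open>d i j\<close>, so every distance \<open>r\<close> is tried. A greedy net of points
  at pairwise distance more than \<open>2 r\<close> has disjoint balls of radius \<open>r\<close>, and a solution of radius
  \<open>r\<close> meets all of them; conversely an independent set meeting all of them has radius at most
  \<open>3 r\<close>. So it suffices to find an independent transversal of the balls of minimum weight, that is,
  to solve a weighted matroid intersection problem with a partition matroid.

  This is done by a primal-dual method that needs no augmenting paths. To each ball a free dummy
  element of weight \<open>0\<close> is added, and the dummies form the first transversal. A phase withdraws one
  dummy by moving it to an additional ball, which leaves a hole in its old ball. From a minimum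
  transversal \<open>S h\<close> of all balls but \<open>h\<close>, a swap of \<open>x\<close> in ball \<open>h\<close> for \<open>y\<close> in ball \<open>l\<close> gives a
  transversal of all balls but \<open>l\<close>. The prices of the holes reached so far are lowered until a swap
  to a new hole costs nothing. The sets \<open>S h\<close> stay minimal because a lower bound on the slack of
  the swaps is transferred between two sets that differ by a costless swap. The phase is over when
  the additional ball is the hole.
\<close>

section \<open>Minimum weight independent sets and the search for a hole\<close>

text \<open>The optimality certificate is a weight splitting. An element costs its weight plus the
  price of its ball, and every \<open>S h\<close> is kept cheapest among all independent sets of its
  size (\<open>min_indep\<close>), a condition in which the balls do not occur. A transversal uses
  each ball once, so its total price is its weight plus a constant; a cheapest set that is a
  transversal therefore has minimum weight. The obstacle is that performing several swaps along a
  path of the exchange graph need not preserve independence, which is usually overcome by a shortest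
  path argument. Here each reached hole stores a complete set, and only single swaps checked by the
  oracle are made. This moves the difficulty elsewhere: the search looks only at swaps that fill the
  hole of the stored set, while minimality after a price change concerns all swaps of all stored
  sets. The slack transfer closes this gap, both when a swap is made and when none is left. Dummies
  of points outside the net are never withdrawn, so the balls can be numbered by all points.\<close>

context matroid
begin

section \<open>Exchange and single swaps in a matroid\<close>

lemma finite_indep: "A \<in> \<I> \<Longrightarrow> finite A"
  using finite_ground indep_subset_ground finite_subset by blast

lemma indep_extend:
  assumes "A \<in> \<I>" "B \<in> \<I>" "card A \<le> card B"
  shows "\<exists>C \<in> \<I>. A \<subseteq> C \<and> C \<subseteq> A \<union> B \<and> card C = card B"
  using assms
proof (induction "card B - card A" arbitrary: A)
  case 0
  then show ?case by (intro bexI[of _ A]) auto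
next
  case (Suc i)
  then have "card A < card B" by simp
  then obtain x where x: "x \<in> B - A" "insert x A \<in> \<I>"
    using exchange Suc.prems by blast
  have "card (insert x A) = Suc (card A)"
    using x finite_indep[OF Suc.prems(1)] by simp
  then have "\<exists>C \<in> \<I>. insert x A \<subseteq> C \<and> C \<subseteq> insert x A \<union> B \<and> card C = card B"
    using Suc.hyps x Suc.prems \<open>card A < card B\<close> by (intro Suc.hyps(1)) auto
  with x show ?case by blast
qed

lemma card_swap:
  assumes "S \<in> \<I>" "y \<in> S" "x \<notin> S"
  shows "card (insert x (S - {y})) = card S"
  using finite_indep[OF assms(1)] assms(2,3) card_Suc_Diff1[of S y] by simp

text \<open>Grow \<open>insert x A\<close> to size \<open>card S\<close> by elements of
  \<open>S\<close>: one element of \<open>S\<close> is left out, and it cannot lie in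
  \<open>A\<close>. This takes the place of arguments with fundamental circuits.\<close>

lemma indep_extend_swap:
  assumes S: "S \<in> \<I>" and A: "insert x A \<in> \<I>" "A \<subset> S" "x \<notin> S"
  shows "\<exists>y \<in> S - A. insert x (S - {y}) \<in> \<I>"
proof -
  have fin: "finite S" using S finite_indep by blast
  have "card (insert x A) \<le> card S"
    using psubset_card_mono[OF fin A(2)] finite_subset[of A S] A fin by (simp add: card_insert_if)
  then obtain C where C: "C \<in> \<I>" "insert x A \<subseteq> C" "C \<subseteq> insert x A \<union> S" "card C = card S"
    using indep_extend[OF A(1) S] by blast
  have "card (C - {x}) < card S"
    using C fin A(2) by (metis (no_types, opaque_lifting) card_Diff1_less finite_indep insert_subset)
  then have "\<not> S \<subseteq> C - {x}" using fin C(1) finite_indep card_mono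
    by (metis finite_Diff not_le)
  then obtain y where y: "y \<in> S" "y \<notin> C" using A(3) by auto
  have "C \<subseteq> insert x (S - {y})" using C(3) A(2) y by auto
  then have "C = insert x (S - {y})"
    using card_swap[OF S y(1) A(3)] C(4) fin by (intro card_subset_eq) auto
  then show ?thesis using y C by auto
qed

section \<open>Local optimality of minimum weight independent sets\<close>

definition min_indep :: "('a \<Rightarrow> real) \<Rightarrow> 'a set \<Rightarrow> 'a set \<Rightarrow> bool" where
  "min_indep q U S \<longleftrightarrow> S \<in> \<I> \<and> S \<subseteq> U \<and>
    (\<forall>T \<in> \<I>. T \<subseteq> U \<longrightarrow> card T = card S \<longrightarrow> sum q S \<le> sum q T)"

lemma sum_swap:
  fixes q :: "'a \<Rightarrow> real"
  assumes "S \<in> \<I>" "y \<in> S" "x \<notin> S"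
  shows "sum q (insert x (S - {y})) = sum q S - q y + q x"
  using finite_indep[OF assms(1)] assms(2,3) by (simp add: sum_diff1)

text \<open>A competitor \<open>T\<close> is moved towards \<open>S\<close> by one swap that does
  not raise its price, and \<open>card (S - T)\<close> decreases.\<close>

lemma min_indep_local:
  assumes S: "S \<in> \<I>" "S \<subseteq> U"
    and opt: "\<And>x y. x \<in> U - S \<Longrightarrow> y \<in> S \<Longrightarrow> insert x (S - {y}) \<in> \<I> \<Longrightarrow> q y \<le> q x"
  shows "min_indep q U S"
proof -
  have fin: "finite S" using S finite_indep by blast
  have "sum q S \<le> sum q T" if "T \<in> \<I>" "T \<subseteq> U" "card T = card S" for T
    using that
  proof (induction "card (S - T)" arbitrary: T rule: less_induct)
    case less
    have finT: "finite T" using less finite_indep by blast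
    show ?case
    proof (cases "S \<subseteq> T")
      case True
      then have "S = T" using card_subset_eq[OF finT True] less(4) by simp
      then show ?thesis by simp
    next
      case False
      \<comment> \<open>As the cheapest element of \<open>S - T\<close>, \<open>y\<close> costs no
        more than whichever \<open>z\<close> turns out to be replaceable by \<open>x\<close> in
        \<open>S\<close>; this gives \<open>q y \<le> q z \<le> q x\<close>.\<close>
      define y where "y = arg_min_on q (S - T)"
      have y: "y \<in> S" "y \<notin> T" and ymin: "\<And>z. z \<in> S - T \<Longrightarrow> q y \<le> q z"
        using arg_min_if_finite[of "S - T" q] False fin
        unfolding y_def by (auto intro: arg_min_least)
      have "insert y (S \<inter> T) \<in> \<I>" using indep_subset[OF S(1)] y by auto
      moreover have "S \<inter> T \<subset> T"
        using y less(4) fin finT by (metis Int_lower1 Int_lower2 card_subset_eq inf.orderE psubsetI)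
      ultimately obtain x where x: "x \<in> T - S \<inter> T" "insert y (T - {x}) \<in> \<I>"
        using indep_extend_swap[OF less(2)] y by blast
      have "insert x (S \<inter> T) \<in> \<I>" using indep_subset[OF less(2)] x by auto
      moreover have "S \<inter> T \<subset> S" using False by blast
      ultimately obtain z where z: "z \<in> S - S \<inter> T" "insert x (S - {z}) \<in> \<I>"
        using indep_extend_swap[OF S(1)] x by blast
      have "q z \<le> q x" using opt x z less(3) by blast
      then have yx: "q y \<le> q x" using ymin[of z] z by auto
      have "S - insert y (T - {x}) = (S - T) - {y}" using x by auto
      then have "card (S - insert y (T - {x})) < card (S - T)"
        using card_Diff1_less[of "S - T" y] y fin by simp
      then have "sum q S \<le> sum q (insert y (T - {x}))"
        using less x y S card_swap[OF less(2), of x y] by (intro less(1)) auto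
      also have "\<dots> = sum q T - q x + q y" using sum_swap[OF less(2), of x y] x y by auto
      finally show ?thesis using yx by simp
    qed
  qed
  then show ?thesis using S unfolding min_indep_def by blast
qed

lemma min_indepD:
  assumes "min_indep q U S"
  shows "S \<in> \<I>" "S \<subseteq> U"
    "T \<in> \<I> \<Longrightarrow> T \<subseteq> U \<Longrightarrow> card T = card S \<Longrightarrow> sum q S \<le> sum q T"
  using assms by (simp_all add: min_indep_def)

lemma min_indep_swap_le:
  assumes S: "min_indep q U S" and xy: "x \<in> U - S" "y \<in> S" "insert x (S - {y}) \<in> \<I>"
  shows "q y \<le> q x"
proof -
  note D = min_indepD[OF S]
  have "insert x (S - {y}) \<subseteq> U" "x \<notin> S" using D xy by auto
  then have "sum q S \<le> sum q (insert x (S - {y}))"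
    using D(3)[OF xy(3)] card_swap[OF D(1) xy(2)] by simp
  then show ?thesis using sum_swap[OF D(1) xy(2) \<open>x \<notin> S\<close>, of q] by simp
qed

lemma min_indep_swap:
  assumes S: "min_indep q U S" and xy: "x \<in> U - S" "y \<in> S" "insert x (S - {y}) \<in> \<I>" "q x = q y"
  shows "min_indep q U (insert x (S - {y}))"
proof -
  note D = min_indepD[OF S]
  have "insert x (S - {y}) \<subseteq> U" "x \<notin> S" using D xy by auto
  moreover have "sum q (insert x (S - {y})) = sum q S"
    using sum_swap[OF D(1) xy(2) \<open>x \<notin> S\<close>, of q] xy by simp
  ultimately show ?thesis
    using D(3) card_swap[OF D(1) xy(2)] xy(3) by (simp add: min_indep_def)
qed

text \<open>Since \<open>x'\<close> alone cannot replace \<open>y'\<close>, exchange of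
  \<open>S - {y'}\<close> against the doubly swapped set must supply \<open>x\<close>. Likewise,
  when \<open>x'\<close> is fitted into \<open>S\<close> while \<open>S - {y, y'}\<close> is kept,
  the element removed must be \<open>y\<close>.\<close>

lemma double_swap:
  assumes S: "S \<in> \<I>" "y \<in> S" "y' \<in> S" "y \<noteq> y'" "x \<notin> S" "x' \<notin> S" "x \<noteq> x'"
    and SS: "insert x' (insert x (S - {y}) - {y'}) \<in> \<I>"
    and no: "insert x' (S - {y'}) \<notin> \<I>"
  shows "insert x (S - {y'}) \<in> \<I>" "insert x' (S - {y}) \<in> \<I>"
proof -
  let ?D = "insert x' (insert x (S - {y}) - {y'})"
  have fin: "finite S" using S finite_indep by blast
  have "card (insert x (S - {y}) - {y'}) = card S - 1"
    using card_swap[of S y x] S fin by (subst card_Diff_singleton) auto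
  then have cD: "card ?D = card S"
    using fin S card_gt_0_iff[of S] by (subst card_insert_disjoint) auto
  have "card (S - {y'}) < card ?D" using cD fin S by (simp add: card_Diff1_less)
  moreover have "S - {y'} \<in> \<I>" using indep_subset S by blast
  ultimately obtain z where z: "z \<in> ?D - (S - {y'})" "insert z (S - {y'}) \<in> \<I>"
    using exchange SS by blast
  then have "z = x \<or> z = x'" by auto
  then show "insert x (S - {y'}) \<in> \<I>" using z no by blast
  have "insert x' (S - {y, y'}) \<in> \<I>" by (rule indep_subset[OF SS]) (use S in auto)
  moreover have "S - {y, y'} \<subset> S" using S by auto
  ultimately obtain u where u: "u \<in> S - (S - {y, y'})" "insert x' (S - {u}) \<in> \<I>"
    using indep_extend_swap[OF S(1)] S by blast
  then have "u = y \<or> u = y'" by auto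
  then show "insert x' (S - {y}) \<in> \<I>" using u no by blast
qed

text \<open>\<open>\<delta>\<close> is an amount by which \<open>x\<close> may become cheaper,
  relative to elements outside \<open>B\<close>, before one of these swaps pays off.
  \<open>B\<close> will consist of the elements in reached balls, whose prices drop
  together.\<close>

definition slack_ge :: "('a \<Rightarrow> real) \<Rightarrow> 'a set \<Rightarrow> real \<Rightarrow> 'a set \<Rightarrow> 'a \<Rightarrow> bool" where
  "slack_ge q B \<delta> S x \<longleftrightarrow>
    (\<forall>y \<in> S - B. x \<notin> S \<longrightarrow> insert x (S - {y}) \<in> \<I> \<longrightarrow> \<delta> \<le> q x - q y)"

text \<open>If the swap of \<open>z\<close> for \<open>y'\<close> is possible only after that of \<open>x\<close> for \<open>y\<close>, then \<open>x\<close> can be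
  swapped for \<open>y'\<close> and \<open>z\<close> for \<open>y\<close> beforehand.\<close>

lemma slack_ge_swap:
  assumes opt: "min_indep q U S" and x: "x \<in> U - S" "x \<in> B" and y: "y \<in> S" "y \<in> B"
    and sw: "insert x (S - {y}) \<in> \<I>" "q x = q y"
    and sx: "slack_ge q B \<delta> S x" and sz: "slack_ge q B \<delta> S z" and z: "z \<in> U"
  shows "slack_ge q B \<delta> (insert x (S - {y})) z"
  unfolding slack_ge_def
proof (intro ballI impI)
  fix y' assume y': "y' \<in> insert x (S - {y}) - B" and zn: "z \<notin> insert x (S - {y})"
    and i: "insert z (insert x (S - {y}) - {y'}) \<in> \<I>"
  have S: "S \<in> \<I>" using opt unfolding min_indep_def by auto
  have y'': "y' \<in> S - B" "y' \<noteq> y" "y' \<noteq> x" using y' x y by auto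
  show "\<delta> \<le> q z - q y'"
  proof (cases "z = y")
    case True
    \<comment> \<open>Bringing \<open>y\<close> back in for \<open>y'\<close> amounts to the direct
      swap of \<open>x\<close> for \<open>y'\<close>, at the same cost because
      \<open>q x = q y\<close>.\<close>
    have "insert z (insert x (S - {y}) - {y'}) = insert x (S - {y'})" using y'' y x True by auto
    then show ?thesis using i sx y'' x sw True unfolding slack_ge_def by auto
  next
    case False
    then have zS: "z \<notin> S" "z \<noteq> x" using zn by auto
    show ?thesis
    proof (cases "insert z (S - {y'}) \<in> \<I>")
      case True
      then show ?thesis using sz zS y'' unfolding slack_ge_def by auto
    next
      case no: False
      have "insert x (S - {y'}) \<in> \<I>" "insert z (S - {y}) \<in> \<I>"
        using double_swap[OF S y(1) _ _ _ _ _ i no] y'' x zS by auto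
      \<comment> \<open>With \<open>q x = q y\<close> and minimality of \<open>S\<close>, this gives
        \<open>q z - q y' \<ge> q x - q y' \<ge> \<delta>\<close>.\<close>
      then have "\<delta> \<le> q x - q y'" "q y \<le> q z"
        using sx y'' x min_indep_swap_le[OF opt _ y(1), of z] z zS unfolding slack_ge_def by auto
      then show ?thesis using sw by simp
    qed
  qed
qed

section \<open>The search over holes\<close>

definition links :: "('a \<Rightarrow> nat) \<Rightarrow> ('a \<Rightarrow> real) \<Rightarrow> nat set \<Rightarrow> (nat \<Rightarrow> 'a set) \<Rightarrow> (nat \<times> nat) set" where
  "links b q R S = {(h, l). h \<in> R \<and> l \<in> R \<and>
    (\<exists>x \<in> E. \<exists>y \<in> S h. b x = h \<and> b y = l \<and> q x = q y \<and> S l = insert x (S h - {y}))}"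

lemma linksI:
  assumes "h \<in> R" "l \<in> R" "x \<in> E" "y \<in> S h" "b x = h" "b y = l" "q x = q y"
    "S l = insert x (S h - {y})"
  shows "(h, l) \<in> links b q R S"
  using assms by (auto simp only: links_def mem_Collect_eq case_prod_conv)

text \<open>The links connect all transversals found to the initial one by costless swaps, so that a
  slack bound can be carried from each of them to each other.\<close>

definition hole_search ::
  "('a \<Rightarrow> nat) \<Rightarrow> nat set \<Rightarrow> nat \<Rightarrow> ('a \<Rightarrow> real) \<Rightarrow> nat set \<Rightarrow> (nat \<Rightarrow> 'a set) \<Rightarrow> bool" where
  "hole_search b J s q R S \<longleftrightarrow> finite J \<and> s \<in> R \<and> R \<subseteq> J \<and>
    (\<forall>h \<in> R. min_indep q {e \<in> E. b e \<in> J} (S h) \<and> bij_betw b (S h) (J - {h}) \<and>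
      (s, h) \<in> (links b q R S)\<^sup>*)"

text \<open>A costless swap is undone by a costless swap, so \<open>slack_ge_swap\<close> applies in
  both directions. Each time the entering element lies in the ball that is the hole of the set it
  enters, which is the case covered by \<open>swaps\<close>.\<close>

lemma slack_ge_link:
  assumes hs: "hole_search b J s q R S" and l: "(h, l) \<in> links b q R S"
    and z: "z \<in> E" "b z \<in> J"
    and swaps: "\<And>h x. h \<in> R \<Longrightarrow> x \<in> E \<Longrightarrow> b x = h \<Longrightarrow> slack_ge q {e. b e \<in> R} \<delta> (S h) x"
  shows "slack_ge q {e. b e \<in> R} \<delta> (S h) z \<longleftrightarrow> slack_ge q {e. b e \<in> R} \<delta> (S l) z"
proof -
  obtain x y where hl: "h \<in> R" "l \<in> R" "x \<in> E" "y \<in> S h" "b x = h" "b y = l" "q x = q y"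
    "S l = insert x (S h - {y})"
    using l unfolding links_def by auto
  have mh: "min_indep q {e \<in> E. b e \<in> J} (S h)" and bh: "bij_betw b (S h) (J - {h})"
    and ml: "min_indep q {e \<in> E. b e \<in> J} (S l)" and bl: "bij_betw b (S l) (J - {l})"
    and RJ: "R \<subseteq> J"
    using hs hl unfolding hole_search_def by auto
  have xS: "x \<notin> S h" using bh hl by (auto simp: bij_betw_def)
  have yE: "y \<in> E" using hl mh unfolding min_indep_def by auto
  have yS: "y \<notin> S l" using bl hl by (auto simp: bij_betw_def)
  have undo: "insert y (S l - {x}) = S h" using hl xS by auto
  show ?thesis
  proof
    assume sz: "slack_ge q {e. b e \<in> R} \<delta> (S h) z"
    have "S l \<in> \<I>" using ml unfolding min_indep_def by auto
    then show "slack_ge q {e. b e \<in> R} \<delta> (S l) z"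
      using slack_ge_swap[OF mh, of x "{e. b e \<in> R}" y \<delta> z] hl xS RJ sz z swaps[of h x] by auto
  next
    assume sz: "slack_ge q {e. b e \<in> R} \<delta> (S l) z"
    have "S h \<in> \<I>" using mh unfolding min_indep_def by auto
    then show "slack_ge q {e. b e \<in> R} \<delta> (S h) z"
      using slack_ge_swap[OF ml, of y "{e. b e \<in> R}" x \<delta> z] hl yS RJ sz z swaps[of l y] yE undo by auto
  qed
qed

text \<open>Widens a bound on the swaps that fill the hole of their set to all swaps bringing in an
  element of a reached ball. For \<open>z\<close> the bound is known at the set with hole
  \<open>b z\<close>; the links carry it to the root \<open>S s\<close> and from there to
  \<open>S g\<close>.\<close>

lemma slack_ge_all:
  assumes hs: "hole_search b J s q R S"
    and swaps: "\<And>h x. h \<in> R \<Longrightarrow> x \<in> E \<Longrightarrow> b x = h \<Longrightarrow> slack_ge q {e. b e \<in> R} \<delta> (S h) x"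
    and z: "z \<in> E" "b z \<in> R" and g: "g \<in> R"
  shows "slack_ge q {e. b e \<in> R} \<delta> (S g) z"
proof -
  have zJ: "b z \<in> J" using hs z unfolding hole_search_def by auto
  have conn: "slack_ge q {e. b e \<in> R} \<delta> (S s) z \<longleftrightarrow> slack_ge q {e. b e \<in> R} \<delta> (S h) z"
    if "(s, h) \<in> (links b q R S)\<^sup>*" for h
    using that
  proof (induction rule: rtrancl_induct)
    case base
    then show ?case by simp
  next
    case (step h l)
    have "slack_ge q {e. b e \<in> R} \<delta> (S h) z \<longleftrightarrow> slack_ge q {e. b e \<in> R} \<delta> (S l) z"
      by (rule slack_ge_link[OF hs step(2) z(1) zJ]) (rule swaps)
    then show ?case using step(3) by simp
  qed
  have "(s, h) \<in> (links b q R S)\<^sup>*" if "h \<in> R" for h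
    using hs that unfolding hole_search_def by auto
  then show ?thesis using conn[of g] conn[of "b z"] g z swaps by auto
qed

lemma hole_search_init:
  assumes "min_indep q {e \<in> E. b e \<in> J} S" "bij_betw b S (J - {s})" "s \<in> J" "finite J"
  shows "hole_search b J s q {s} (\<lambda>_. S)"
  using assms unfolding hole_search_def by auto

lemma hole_search_cong:
  assumes "hole_search b J s q R S"
    and "\<And>h. h \<in> R \<Longrightarrow> S' h = S h" "\<And>e. e \<in> E \<Longrightarrow> b e \<in> J \<Longrightarrow> q' e = q e"
  shows "hole_search b J s q' R S'"
proof -
  have U: "S h \<subseteq> {e \<in> E. b e \<in> J}" if "h \<in> R" for h
    using assms(1) that unfolding hole_search_def min_indep_def by blast
  have RJ: "R \<subseteq> J" using assms(1) unfolding hole_search_def by auto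
  have s: "sum q' T = sum q T" if "T \<subseteq> {e \<in> E. b e \<in> J}" for T
    using that by (intro sum.cong) (auto intro: assms(3))
  have "min_indep q' {e \<in> E. b e \<in> J} (S h)" if "min_indep q {e \<in> E. b e \<in> J} (S h)" for h
    using that s unfolding min_indep_def by simp
  moreover have "links b q R S \<subseteq> links b q' R S'"
  proof
    fix hl assume "hl \<in> links b q R S"
    then obtain h l x y where hl: "hl = (h, l)" "h \<in> R" "l \<in> R" "x \<in> E" "y \<in> S h" "b x = h"
      "b y = l" "q x = q y" "S l = insert x (S h - {y})"
      unfolding links_def by auto
    have "b x \<in> J" "y \<in> E" "b y \<in> J" using hl U[OF hl(2)] RJ by auto
    with hl have "q' x = q' y" using assms(3)[of x] assms(3)[of y] by simp
    then show "hl \<in> links b q' R S'" using hl assms(2) unfolding links_def by auto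
  qed
  ultimately show ?thesis
    using assms(1,2) rtrancl_mono[of "links b q R S" "links b q' R S'"]
    unfolding hole_search_def by auto
qed

text \<open>Lowering the reached balls by the least slack keeps the old sets minimal and makes the
  chosen swap costless, so the new set is minimal too. Old links survive because both elements
  swapped lie in reached balls and get cheaper by the same amount.\<close>

lemma hole_search_step:
  assumes hs: "hole_search b J s q R S"
    and hxy: "h \<in> R" "x \<in> E" "b x = h" "y \<in> S h" "b y \<notin> R" "insert x (S h - {y}) \<in> \<I>"
    and minimal: "\<And>h' x' y'. h' \<in> R \<Longrightarrow> x' \<in> E \<Longrightarrow> b x' = h' \<Longrightarrow> y' \<in> S h' \<Longrightarrow> b y' \<notin> R \<Longrightarrow>
      insert x' (S h' - {y'}) \<in> \<I> \<Longrightarrow> q x - q y \<le> q x' - q y'"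
    and q': "\<And>e. q' e = (if b e \<in> R then q e - (q x - q y) else q e)"
  shows "hole_search b J s q' (insert (b y) R) (S(b y := insert x (S h - {y})))"
proof -
  let ?U = "{e \<in> E. b e \<in> J}" and ?S = "S(b y := insert x (S h - {y}))" and ?R = "insert (b y) R"
  have RJ: "R \<subseteq> J" "finite J" "s \<in> R" using hs unfolding hole_search_def by auto
  have opt: "min_indep q ?U (S g)" and bij: "bij_betw b (S g) (J - {g})" if "g \<in> R" for g
    using hs that unfolding hole_search_def by auto
  have xS: "x \<notin> S h" and byJ: "b y \<in> J" and inj: "inj_on b (S h)" "b ` S h = J - {h}"
    using bij[OF hxy(1)] hxy by (auto simp: bij_betw_def)
  have all: "slack_ge q {e. b e \<in> R} (q x - q y) (S g) z" if "z \<in> E" "b z \<in> R" "g \<in> R" for z g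
    by (rule slack_ge_all[OF hs _ that]) (use minimal in \<open>auto simp: slack_ge_def\<close>)
  \<comment> \<open>The sign matters for swaps that replace an element of a reached ball by one of
    an unreached ball: their price difference grows by this amount.\<close>
  have nonneg: "0 \<le> q x - q y"
    using min_indep_swap_le[OF opt[OF hxy(1)], of x y] hxy RJ xS by auto
  have opt': "min_indep q' ?U (S g)" if g: "g \<in> R" for g
  proof (rule min_indep_local)
    show "S g \<in> \<I>" "S g \<subseteq> ?U" using opt[OF g] unfolding min_indep_def by auto
    fix z u assume z: "z \<in> ?U - S g" and u: "u \<in> S g" and i: "insert z (S g - {u}) \<in> \<I>"
    have "q u \<le> q z" using min_indep_swap_le[OF opt[OF g] z u i] .
    \<comment> \<open>These are the only swaps that lose slack. The bound \<open>all\<close> is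
      needed because \<open>z\<close> need not lie in the hole \<open>g\<close> of
      \<open>S g\<close>.\<close>
    moreover have "q x - q y \<le> q z - q u" if "b z \<in> R" "b u \<notin> R"
      using all[OF _ that(1) g] that z u i unfolding slack_ge_def by auto
    ultimately show "q' u \<le> q' z" unfolding q' using nonneg by auto
  qed
  have tight: "q' x = q' y" unfolding q' using hxy by auto
  have new: "min_indep q' ?U (insert x (S h - {y}))"
    using min_indep_swap[OF opt'[OF hxy(1)], of x y] hxy xS RJ tight by auto
  have newbij: "bij_betw b (insert x (S h - {y})) (J - {b y})"
  proof -
    have "inj_on b (insert x (S h - {y}))"
      using inj hxy xS by (auto simp: inj_on_def)
    moreover have "b ` (insert x (S h - {y})) = J - {b y}"
    proof -
      have "b ` (S h - {y}) = J - {h} - {b y}"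
        using inj_on_image_set_diff[OF inj(1), of "S h" "{y}"] inj(2) hxy by auto
      then show ?thesis using hxy RJ by auto
    qed
    ultimately show ?thesis by (simp add: bij_betw_def)
  qed
  have old: "links b q R S \<subseteq> links b q' ?R ?S"
  proof
    fix gl assume "gl \<in> links b q R S"
    then obtain g l u v where gl: "gl = (g, l)" "g \<in> R" "l \<in> R" "u \<in> E" "v \<in> S g" "b u = g"
      "b v = l" "q u = q v" "S l = insert u (S g - {v})"
      unfolding links_def by auto
    moreover have "g \<noteq> b y" "l \<noteq> b y" using gl hxy by auto
    moreover have "q' u = q' v" unfolding q' using gl by auto
    ultimately show "gl \<in> links b q' ?R ?S"
      unfolding gl(1) by (intro linksI[where x = u and y = v]) simp_all
  qed
  have new_link: "(h, b y) \<in> links b q' ?R ?S"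
  proof -
    have "h \<noteq> b y" using hxy by auto
    then show ?thesis using hxy tight by (intro linksI[where x = x and y = y]) simp_all
  qed
  have R: "(s, g) \<in> (links b q' ?R ?S)\<^sup>*" if "g \<in> R" for g
    using hs that subsetD[OF rtrancl_mono[OF old]] unfolding hole_search_def by simp
  have "(s, b y) \<in> (links b q' ?R ?S)\<^sup>*"
    using rtrancl.rtrancl_into_rtrancl[OF R[OF hxy(1)] new_link] .
  with R have conn: "(s, g) \<in> (links b q' ?R ?S)\<^sup>*" if "g \<in> ?R" for g
    using that by auto
  have ne: "g \<noteq> b y" if "g \<in> R" for g using that hxy by auto
  show ?thesis
    unfolding hole_search_def using RJ byJ opt' bij new newbij conn ne by auto
qed

text \<open>Within the reached balls \<open>S s\<close> has fewer elements than \<open>T\<close>,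
  because its hole \<open>s\<close> is reached and \<open>t\<close> is not. Exchange then yields a
  swap into a reached ball that vacates an unreached one, and slack transfer excludes it.\<close>

lemma hole_search_stuck:
  assumes hs: "hole_search b J s q R S" and t: "t \<in> J - R"
    and stuck: "\<And>h x y. h \<in> R \<Longrightarrow> x \<in> E \<Longrightarrow> b x = h \<Longrightarrow> y \<in> S h \<Longrightarrow> b y \<notin> R \<Longrightarrow>
      insert x (S h - {y}) \<notin> \<I>"
  shows "\<not> (\<exists>T \<in> \<I>. bij_betw b T (J - {t}))"
proof
  assume "\<exists>T \<in> \<I>. bij_betw b T (J - {t})"
  then obtain T where T: "T \<in> \<I>" "bij_betw b T (J - {t})" by blast
  let ?B = "{e. b e \<in> R}"
  have RJ: "R \<subseteq> J" "finite J" "s \<in> R" using hs unfolding hole_search_def by auto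
  have Ss: "S s \<in> \<I>" "bij_betw b (S s) (J - {s})"
    using hs RJ unfolding hole_search_def min_indep_def by auto
  have count: "card (A \<inter> ?B) = card (R - {g})" if "bij_betw b A (J - {g})" for A g
  proof -
    have "b ` (A \<inter> ?B) = R - {g}" using that RJ by (auto simp: bij_betw_def)
    then have "bij_betw b (A \<inter> ?B) (R - {g})"
      using that by (auto simp: bij_betw_def intro: inj_on_subset)
    then show ?thesis by (rule bij_betw_same_card)
  qed
  have "card (S s \<inter> ?B) < card (T \<inter> ?B)"
    using count[OF Ss(2)] count[OF T(2)] t RJ card_Diff1_less[of R s] finite_subset[of R J]
    by auto
  moreover have "S s \<inter> ?B \<in> \<I>" "T \<inter> ?B \<in> \<I>" using indep_subset Ss T by auto
  ultimately obtain x where x: "x \<in> T \<inter> ?B - S s \<inter> ?B" "insert x (S s \<inter> ?B) \<in> \<I>"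
    using exchange by blast
  have xE: "x \<in> E" using x T indep_subset_ground by auto
  have "t \<in> b ` S s" using Ss(2) t RJ by (auto simp: bij_betw_def)
  then have "S s \<inter> ?B \<subset> S s" using t by auto
  then obtain y where y: "y \<in> S s - S s \<inter> ?B" "insert x (S s - {y}) \<in> \<I>"
    using indep_extend_swap[OF Ss(1) x(2)] x by auto
  \<comment> \<open>No hole-filling swap exists, so any bound satisfies the hypothesis of
    \<open>slack_ge_all\<close> vacuously; a bound above the actual slack gives the
    contradiction.\<close>
  let ?d = "q x - q y + 1"
  have "slack_ge q ?B ?d (S s) x"
    by (rule slack_ge_all[OF hs]) (use stuck x xE RJ in \<open>auto simp: slack_ge_def\<close>)
  then show False using x y unfolding slack_ge_def by auto
qed

end

section \<open>Programs with bounded loops\<close>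

lemma nats_nat_update [simp]: "nats (nat_update x is a s) = (nats s)(x := (nats s x)(is := a))"
  and reals_nat_update [simp]: "reals (nat_update x is a s) = reals s"
  and nats_real_update [simp]: "nats (real_update x is c s) = nats s"
  and reals_real_update [simp]: "reals (real_update x is c s) = (reals s)(x := (reals s x)(is := c))"
  by (simp_all add: nat_update_def real_update_def)

text \<open>A sublanguage without general loops: termination is structural, so \<open>run\<close> is
  a total function and a cost bound can be read off the syntax.\<close>

datatype prog =
    PSkip
  | PNat vname "nexp list" nexp
  | PReal vname "nexp list" rexp
  | PSeq prog prog (infixr \<open>;;\<close> 60)
  | PIf bexp prog prog
  | PFor vname vname prog

primrec compile :: "prog \<Rightarrow> com" where
  "compile PSkip = Skip"
| "compile (PNat x es a) = NAssign x es a"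
| "compile (PReal x es a) = RAssign x es a"
| "compile (c ;; c') = Seq (compile c) (compile c')"
| "compile (PIf b c c') = Cond b (compile c) (compile c')"
| "compile (PFor i b c) = Seq (NAssign i [] (NConst 0))
    (While (NLess (NRead i []) (NRead b []))
      (Seq (compile c) (NAssign i [] (NPlus (NRead i []) (NConst 1)))))"

primrec run :: "nat set set \<Rightarrow> prog \<Rightarrow> state \<Rightarrow> state" where
  "run \<I> PSkip s = s"
| "run \<I> (PNat x es a) s = nat_update x (map (\<lambda>e. nval e s) es) (nval a s) s"
| "run \<I> (PReal x es a) s = real_update x (map (\<lambda>e. nval e s) es) (rval a s) s"
| "run \<I> (c ;; c') s = run \<I> c' (run \<I> c s)"
| "run \<I> (PIf b c c') s = (if bval \<I> b s then run \<I> c s else run \<I> c' s)"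
| "run \<I> (PFor i b c) s =
    ((\<lambda>s. nat_update i [] (Suc (nats s i [])) (run \<I> c s)) ^^ nats s b []) (nat_update i [] 0 s)"

primrec nvars :: "prog \<Rightarrow> vname set" where
  "nvars PSkip = {}"
| "nvars (PNat x es a) = {x}"
| "nvars (PReal x es a) = {}"
| "nvars (c ;; c') = nvars c \<union> nvars c'"
| "nvars (PIf b c c') = nvars c \<union> nvars c'"
| "nvars (PFor i b c) = insert i (nvars c)"

primrec rvars :: "prog \<Rightarrow> vname set" where
  "rvars PSkip = {}"
| "rvars (PNat x es a) = {}"
| "rvars (PReal x es a) = {x}"
| "rvars (c ;; c') = rvars c \<union> rvars c'"
| "rvars (PIf b c c') = rvars c \<union> rvars c'"
| "rvars (PFor i b c) = rvars c"

primrec loop_bounds :: "prog \<Rightarrow> vname set" where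
  "loop_bounds PSkip = {}"
| "loop_bounds (PNat x es a) = {}"
| "loop_bounds (PReal x es a) = {}"
| "loop_bounds (c ;; c') = loop_bounds c \<union> loop_bounds c'"
| "loop_bounds (PIf b c c') = loop_bounds c \<union> loop_bounds c'"
| "loop_bounds (PFor i b c) = insert b (loop_bounds c)"

primrec loops_ok :: "prog \<Rightarrow> bool" where
  "loops_ok PSkip = True"
| "loops_ok (PNat x es a) = True"
| "loops_ok (PReal x es a) = True"
| "loops_ok (c ;; c') = (loops_ok c \<and> loops_ok c')"
| "loops_ok (PIf b c c') = (loops_ok c \<and> loops_ok c')"
| "loops_ok (PFor i b c) = (i \<notin> nvars c \<and> loops_ok c)"

text \<open>The cost is a polynomial in a common upper bound of all loop bounds.\<close>

primrec cost :: "prog \<Rightarrow> nat poly" where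
  "cost PSkip = 1"
| "cost (PNat x es a) = 1"
| "cost (PReal x es a) = 1"
| "cost (c ;; c') = cost c + cost c'"
| "cost (PIf b c c') = cost c + cost c' + 1"
| "cost (PFor i b c) = [:0, 1:] * (cost c + 2) + 2"

lemma nats_run: "x \<notin> nvars c \<Longrightarrow> nats (run \<I> c s) x = nats s x"
proof (induction c arbitrary: s)
  case (PFor i b c)
  have "nats (((\<lambda>s. nat_update i [] (Suc (nats s i [])) (run \<I> c s)) ^^ k) (nat_update i [] 0 s)) x
      = nats s x" for k
    using PFor by (induction k) auto
  then show ?case by simp
qed auto

lemma reals_run: "x \<notin> rvars c \<Longrightarrow> reals (run \<I> c s) x = reals s x"
proof (induction c arbitrary: s)
  case (PFor i b c)
  have "reals (((\<lambda>s. nat_update i [] (Suc (nats s i [])) (run \<I> c s)) ^^ k) (nat_update i [] 0 s)) x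
      = reals s x" for k
    using PFor by (induction k) auto
  then show ?case by simp
qed auto

text \<open>\<open>run\<close> increments the counter value from before the body, so the rule asks
  nothing of the body. The compiled loop increments the value found after the body; the two agree by
  \<open>loops_ok\<close>.\<close>

lemma run_PFor:
  assumes "P 0 (nat_update i [] 0 s)"
    and step: "\<And>k s'. k < nats s b [] \<Longrightarrow> nats s' i [] = k \<Longrightarrow> P k s' \<Longrightarrow>
      P (Suc k) (nat_update i [] (Suc k) (run \<I> c s'))"
  shows "P (nats s b []) (run \<I> (PFor i b c) s)"
proof -
  let ?f = "\<lambda>s. nat_update i [] (Suc (nats s i [])) (run \<I> c s)"
  have "k \<le> nats s b [] \<Longrightarrow> P k ((?f ^^ k) (nat_update i [] 0 s)) \<and>
      nats ((?f ^^ k) (nat_update i [] 0 s)) i [] = k" for k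
    using assms by (induction k) auto
  then show ?thesis by simp
qed

text \<open>Disjointness of \<open>nvars\<close> and \<open>loop_bounds\<close> makes the compiled
  test compare with the same bound in every round.\<close>

lemma exec_compile:
  assumes "loops_ok c" "nvars c \<inter> loop_bounds c = {}" "\<forall>b \<in> loop_bounds c. nats s b [] \<le> N"
  shows "\<exists>t \<le> poly (cost c) N. exec \<I> (compile c) s t (run \<I> c s)"
  using assms
proof (induction c arbitrary: s)
  case PSkip
  then show ?case using exec.Skip by auto
next
  case (PNat x es a)
  then show ?case using exec.NAssign by auto
next
  case (PReal x es a)
  then show ?case using exec.RAssign by auto
next
  case (PSeq c c')
  have "\<exists>t \<le> poly (cost c) N. exec \<I> (compile c) s t (run \<I> c s)"
    using PSeq.prems by (intro PSeq.IH(1)) auto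
  moreover have "nats (run \<I> c s) b = nats s b" if "b \<in> loop_bounds c'" for b
    using that PSeq.prems by (intro nats_run) auto
  then have "\<exists>t \<le> poly (cost c') N. exec \<I> (compile c') (run \<I> c s) t (run \<I> c' (run \<I> c s))"
    using PSeq.prems by (intro PSeq.IH(2)) auto
  ultimately show ?case using exec.Seq by (auto intro!: add_mono)
next
  case (PIf b c c')
  show ?case
  proof (cases "bval \<I> b s")
    case True
    have "\<exists>t \<le> poly (cost c) N. exec \<I> (compile c) s t (run \<I> c s)"
      using PIf.prems by (intro PIf.IH(1)) auto
    then obtain t where "t \<le> poly (cost c) N" "exec \<I> (compile c) s t (run \<I> c s)" by blast
    then show ?thesis using exec.CondTrue[OF True] True by (intro exI[of _ "t + 1"]) auto
  next
    case False
    have "\<exists>t \<le> poly (cost c') N. exec \<I> (compile c') s t (run \<I> c' s)"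
      using PIf.prems by (intro PIf.IH(2)) auto
    then obtain t where "t \<le> poly (cost c') N" "exec \<I> (compile c') s t (run \<I> c' s)" by blast
    then show ?thesis using exec.CondFalse[OF False] False by (intro exI[of _ "t + 1"]) auto
  qed
next
  case (PFor i b c)
  let ?w = "While (NLess (NRead i []) (NRead b []))
    (Seq (compile c) (NAssign i [] (NPlus (NRead i []) (NConst 1))))"
  let ?f = "\<lambda>s. nat_update i [] (Suc (nats s i [])) (run \<I> c s)"
  let ?C = "poly (cost c) N"
  let ?M = "nats s b []"
  have bi: "b \<noteq> i" "b \<notin> nvars c" "i \<notin> nvars c" using PFor.prems by auto
  have body: "\<exists>t \<le> ?C. exec \<I> (compile c) s' t (run \<I> c s')"
    if "\<forall>b' \<in> loop_bounds c. nats s' b' [] = nats s b' []" for s'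
    using PFor.prems that by (intro PFor.IH) auto
  \<comment> \<open>A round costs its body, the increment and the test; the final summand 1 is the
    failing test.\<close>
  have loop: "\<exists>t \<le> m * (?C + 2) + 1. exec \<I> ?w s' t ((?f ^^ m) s')"
    if "nats s' i [] + m = ?M" "\<forall>b' \<in> insert b (loop_bounds c). nats s' b' [] = nats s b' []" for m s'
    using that
  proof (induction m arbitrary: s')
    case 0
    then have "\<not> bval \<I> (NLess (NRead i []) (NRead b [])) s'" by simp
    from exec.WhileFalse[OF this] show ?case by auto
  next
    case (Suc m)
    then have t: "bval \<I> (NLess (NRead i []) (NRead b [])) s'" by simp
    obtain t where t1: "t \<le> ?C" "exec \<I> (compile c) s' t (run \<I> c s')"
      using body[of s'] Suc.prems by auto
    have i': "nats (run \<I> c s') i [] = nats s' i []" using nats_run[OF bi(3)] by simp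
    have "exec \<I> (NAssign i [] (NPlus (NRead i []) (NConst 1))) (run \<I> c s') 1 (?f s')"
      using exec.NAssign[of \<I> i "[]" "NPlus (NRead i []) (NConst 1)" "run \<I> c s'"] i' by simp
    from exec.Seq[OF t1(2) this]
    have ex: "exec \<I> (Seq (compile c) (NAssign i [] (NPlus (NRead i []) (NConst 1)))) s' (t + 1) (?f s')" .
    have "nats (?f s') b' [] = nats s b' []" if "b' \<in> insert b (loop_bounds c)" for b'
    proof -
      have "b' \<noteq> i" "b' \<notin> nvars c" using that PFor.prems by auto
      then show ?thesis using nats_run[of b' c] Suc.prems(2) that by auto
    qed
    then obtain u where u: "u \<le> m * (?C + 2) + 1" "exec \<I> ?w (?f s') u ((?f ^^ m) (?f s'))"
      using Suc.IH[of "?f s'"] Suc.prems by auto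
    have "exec \<I> ?w s' (t + 1 + u + 1) ((?f ^^ Suc m) s')"
      using exec.WhileTrue[OF t ex u(2)] by (simp only: funpow_Suc_right comp_apply)
    moreover have "t + 1 + u + 1 \<le> Suc m * (?C + 2) + 1" using t1 u by simp
    ultimately show ?case by blast
  qed
  have "nats (nat_update i [] 0 s) b' [] = nats s b' []" if "b' \<in> insert b (loop_bounds c)" for b'
    using that PFor.prems by auto
  then obtain u where u: "u \<le> ?M * (?C + 2) + 1"
    "exec \<I> ?w (nat_update i [] 0 s) u ((?f ^^ ?M) (nat_update i [] 0 s))"
    using loop[of "nat_update i [] 0 s" ?M] by auto
  have "exec \<I> (NAssign i [] (NConst 0)) s 1 (nat_update i [] 0 s)"
    using exec.NAssign[of \<I> i "[]" "NConst 0" s] by simp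
  from exec.Seq[OF this u(2)] have "exec \<I> (compile (PFor i b c)) s (1 + u) (run \<I> (PFor i b c) s)"
    by simp
  moreover have "?M * (?C + 2) \<le> N * (?C + 2)" using PFor.prems by (intro mult_right_mono) auto
  then have "1 + u \<le> poly (cost (PFor i b c)) N" using u by simp
  ultimately show ?case by blast
qed

declare run.simps(6) [simp del]

text \<open>A loop writing \<open>f k\<close> to cell \<open>g k\<close>. While the body is
  analysed, cells outside the range may be assumed to hold their old values; this is needed to copy
  one row of an array to another row of the same array.\<close>

lemma run_fill_nat:
  fixes s :: state and f :: "nat \<Rightarrow> nat"
  assumes ix: "i \<noteq> x" and inj: "inj g"
    and cells: "\<And>(s' :: state) k. k < nats s b [] \<Longrightarrow> nats s' i [] = k \<Longrightarrow>
      (\<And>z. z \<noteq> i \<Longrightarrow> z \<noteq> x \<Longrightarrow> nats s' z = nats s z) \<Longrightarrow> reals s' = reals s \<Longrightarrow>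
      (\<And>js. js \<notin> g ` {..<nats s b []} \<Longrightarrow> nats s' x js = nats s x js) \<Longrightarrow>
      map (\<lambda>e. nval e s') es = g k \<and> nval a s' = f k"
  shows "nats (run \<I> (PFor i b (PNat x es a)) s) x =
    (\<lambda>js. if js \<in> g ` {..<nats s b []} then f (inv g js) else nats s x js)"
proof -
  let ?P = "\<lambda>k s'. (\<forall>z. z \<noteq> i \<longrightarrow> z \<noteq> x \<longrightarrow> nats s' z = nats s z) \<and> reals s' = reals s \<and>
    nats s' x = (\<lambda>js. if js \<in> g ` {..<k} then f (inv g js) else nats s x js)"
  have "?P (nats s b []) (run \<I> (PFor i b (PNat x es a)) s)"
  proof (rule run_PFor[where P = ?P])
    show "?P 0 (nat_update i [] 0 s)" using ix by auto
    fix k and s' :: state assume k: "k < nats s b []" "nats s' i [] = k" and P: "?P k s'"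
    have "map (\<lambda>e. nval e s') es = g k \<and> nval a s' = f k"
      using P k by (intro cells) auto
    then show "?P (Suc k) (nat_update i [] (Suc k) (run \<I> (PNat x es a) s'))"
      using P ix inj by (auto simp: fun_eq_iff lessThan_Suc)
  qed
  then show ?thesis by simp
qed

section \<open>The algorithm\<close>

abbreviation "V x \<equiv> NRead x []"
abbreviation "At x i \<equiv> NRead x [i]"
abbreviation "At2 x i j \<equiv> NRead x [i, j]"
abbreviation "Pos a \<equiv> NLess (NConst 0) a"
abbreviation "Zero a \<equiv> BNot (NLess (NConst 0) a)"
abbreviation "NEq a c \<equiv> BAnd (BNot (NLess a c)) (BNot (NLess c a))"
abbreviation "RLe a c \<equiv> BNot (RLess c a)"

text \<open>
  Elements \<open>n + v\<close> are the dummies. The array \<open>b\<close> maps elements to balls, which are named by their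
  net points; \<open>n\<close> is the additional ball of a phase, and \<open>n + 1\<close> stands for no ball. A point that is
  not in the net has a ball that consists of its dummy only. Row \<open>h\<close> of \<open>T\<close> is the transversal with
  hole \<open>h\<close>, the holes reached are marked in \<open>R\<close>, and \<open>f\<close> reports that no transversal exists.
\<close>

definition net_prog :: prog where
  "net_prog =
    PFor ''e'' ''m'' (PNat ''b'' [V ''e''] (V ''l'')) ;;
    PFor ''e'' ''n'' (PNat ''c'' [V ''e''] (NConst 0)) ;;
    PFor ''e'' ''n'' (PNat ''cov'' [V ''e''] (NConst 0)) ;;
    PFor ''v'' ''n'' (PIf (Zero (At ''cov'' (V ''v'')))
      (PNat ''c'' [V ''v''] (NConst 1) ;;
       PFor ''e'' ''n''
         (PIf (RLe (RRead ''d'' [V ''v'', V ''e'']) (RPlus (RRead ''r'' []) (RRead ''r'' [])))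
            (PNat ''cov'' [V ''e''] (NConst 1)) PSkip ;;
          PIf (RLe (RRead ''d'' [V ''v'', V ''e'']) (RRead ''r'' []))
            (PNat ''b'' [V ''e''] (V ''v'')) PSkip))
      PSkip)"

definition init_prog :: prog where
  "init_prog =
    PFor ''e'' ''n'' (PNat ''b'' [NPlus (V ''n'') (V ''e'')] (V ''e'')) ;;
    PFor ''e'' ''l'' (PReal ''p'' [V ''e''] (RConst 0)) ;;
    PFor ''e'' ''n'' (PNat ''I'' [V ''e''] (NConst 0)) ;;
    PFor ''e'' ''n'' (PNat ''I'' [NPlus (V ''n'') (V ''e'')] (NConst 1)) ;;
    PNat ''f'' [] (NConst 0)"

text \<open>The oracle knows only the real points, so dummies are kept out of \<open>Q\<close>;
  inserting or removing a dummy leaves the query unchanged.\<close>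

definition query_prog :: prog where
  "query_prog =
    PFor ''e'' ''n'' (PNat ''Q'' [V ''e''] (At2 ''T'' (V ''h'') (V ''e''))) ;;
    PIf (NLess (V ''y'') (V ''n'')) (PNat ''Q'' [V ''y''] (NConst 0)) PSkip ;;
    PIf (NLess (V ''x'') (V ''n'')) (PNat ''Q'' [V ''x''] (NConst 1)) PSkip"

text \<open>The last guard says that no candidate is stored yet or that the new one is strictly
  cheaper; the language has no disjunction.\<close>

definition try_prog :: prog where
  "try_prog =
    PIf (BAnd (Pos (At ''R'' (V ''h''))) (BAnd (NEq (At ''b'' (V ''x'')) (V ''h''))
        (BAnd (Zero (At ''R'' (At ''b'' (V ''y'')))) (Pos (At2 ''T'' (V ''h'') (V ''y''))))))
      (query_prog ;;
       PReal ''D'' [] (RMinus (RPlus (RRead ''w'' [V ''x'']) (RRead ''p'' [At ''b'' (V ''x'')]))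
         (RPlus (RRead ''w'' [V ''y'']) (RRead ''p'' [At ''b'' (V ''y'')]))) ;;
       PIf (BAnd (Indep ''Q'')
           (BNot (BAnd (Pos (V ''g'')) (RLe (RRead ''dl'' []) (RRead ''D'' [])))))
         (PNat ''g'' [] (NConst 1) ;;
          PReal ''dl'' [] (RRead ''D'' []) ;;
          PNat ''gh'' [] (V ''h'') ;;
          PNat ''gx'' [] (V ''x'') ;;
          PNat ''gy'' [] (V ''y''))
         PSkip)
      PSkip"

definition scan_prog :: prog where
  "scan_prog = PNat ''g'' [] (NConst 0) ;;
    PFor ''h'' ''l'' (PFor ''x'' ''m'' (PFor ''y'' ''m'' try_prog))"

text \<open>Prices drop before the new hole is marked, so the ball of \<open>gy\<close> keeps its
  price and the chosen swap becomes costless.\<close>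

definition grow_prog :: prog where
  "grow_prog =
    PFor ''e'' ''l'' (PIf (Pos (At ''R'' (V ''e'')))
      (PReal ''p'' [V ''e''] (RMinus (RRead ''p'' [V ''e'']) (RRead ''dl'' []))) PSkip) ;;
    PNat ''lb'' [] (At ''b'' (V ''gy'')) ;;
    PFor ''e'' ''m'' (PNat ''T'' [V ''lb'', V ''e''] (At2 ''T'' (V ''gh'') (V ''e''))) ;;
    PNat ''T'' [V ''lb'', V ''gy''] (NConst 0) ;;
    PNat ''T'' [V ''lb'', V ''gx''] (NConst 1) ;;
    PNat ''R'' [V ''lb''] (NConst 1)"

definition step_prog :: prog where
  "step_prog = scan_prog ;; PIf (Pos (V ''g'')) grow_prog (PNat ''f'' [] (NConst 1))"

text \<open>Ball \<open>n\<close> inherits the price of ball \<open>s\<close>: moving the dummy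
  changes the price of no element, so the current set stays minimal.\<close>

definition phase_init_prog :: prog where
  "phase_init_prog =
    PNat ''b'' [NPlus (V ''n'') (V ''s'')] (V ''n'') ;;
    PReal ''p'' [V ''n''] (RRead ''p'' [V ''s'']) ;;
    PFor ''e'' ''l'' (PNat ''R'' [V ''e''] (NConst 0)) ;;
    PNat ''R'' [V ''s''] (NConst 1) ;;
    PFor ''e'' ''m'' (PNat ''T'' [V ''s'', V ''e''] (At ''I'' (V ''e'')))"

text \<open>One of the \<open>n + 1\<close> balls is reached at the start and each successful step
  reaches another, so \<open>n\<close> steps suffice for ball \<open>n\<close>.\<close>

definition phase_prog :: prog where
  "phase_prog = phase_init_prog ;;
    PFor ''t'' ''n'' (PIf (BAnd (Zero (At ''R'' (V ''n''))) (Zero (V ''f''))) step_prog PSkip) ;;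
    PFor ''e'' ''m'' (PNat ''I'' [V ''e''] (At2 ''T'' (V ''n'') (V ''e'')))"

text \<open>A dummy that an earlier phase has already displaced needs no phase of its own. Moving
  the dummy on to \<open>l\<close>, that is to no ball, empties ball \<open>n\<close> for the next
  phase.\<close>

definition transversal_prog :: prog where
  "transversal_prog = PFor ''s'' ''n''
    (PIf (BAnd (Pos (At ''c'' (V ''s''))) (Zero (V ''f'')))
      (PIf (Pos (At ''I'' (NPlus (V ''n'') (V ''s'')))) phase_prog PSkip ;;
       PNat ''b'' [NPlus (V ''n'') (V ''s'')] (V ''l''))
      PSkip)"

definition record_prog :: prog where
  "record_prog =
    PReal ''W'' [] (RConst 0) ;;
    PFor ''e'' ''n'' (PIf (Pos (At ''I'' (V ''e'')))
      (PReal ''W'' [] (RPlus (RRead ''W'' []) (RRead ''w'' [V ''e'']))) PSkip) ;;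
    PIf (BAnd (BAnd (Zero (V ''f'')) (RLe (RRead ''W'' []) (RRead ''k'' [])))
        (BNot (BAnd (Pos (V ''found'')) (RLe (RRead ''best'' []) (RRead ''r'' [])))))
      (PNat ''found'' [] (NConst 1) ;;
       PReal ''best'' [] (RRead ''r'' []) ;;
       PFor ''e'' ''n'' (PNat ''S'' [V ''e''] (At ''I'' (V ''e''))))
      PSkip"

definition radius_prog :: prog where
  "radius_prog = PReal ''r'' [] (RRead ''d'' [V ''i'', V ''j'']) ;;
    net_prog ;; init_prog ;; transversal_prog ;; record_prog"

definition center_prog :: prog where
  "center_prog = PFor ''i'' ''n'' (PFor ''j'' ''n'' radius_prog)"

text \<open>Loop bounds have to be variables, hence the precomputed \<open>m\<close> and
  \<open>l\<close>.\<close>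

definition center_algorithm :: com where
  "center_algorithm =
    Seq (NAssign ''m'' [] (NPlus (V ''n'') (V ''n'')))
      (Seq (NAssign ''l'' [] (NPlus (V ''n'') (NConst 1))) (compile center_prog))"

lemmas prog_defs = center_prog_def radius_prog_def record_prog_def transversal_prog_def
  phase_prog_def phase_init_prog_def step_prog_def grow_prog_def scan_prog_def try_prog_def
  query_prog_def init_prog_def net_prog_def

lemma center_prog_wf: "loops_ok center_prog" "nvars center_prog \<inter> loop_bounds center_prog = {}"
  "loop_bounds center_prog \<subseteq> {''n'', ''m'', ''l''}"
  by (auto simp: prog_defs)

text \<open>Frame information: by contraposition these inclusions become simplification rules
  stating that a program leaves a variable alone.\<close>

lemma nvars_progs:
  "nvars net_prog \<subseteq> {''b'', ''c'', ''cov'', ''e'', ''v''}"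
  "nvars init_prog \<subseteq> {''b'', ''e'', ''I'', ''f''}"
  "nvars query_prog \<subseteq> {''e'', ''Q''}"
  "nvars try_prog \<subseteq> {''e'', ''Q'', ''g'', ''gh'', ''gx'', ''gy''}"
  "nvars scan_prog \<subseteq> {''e'', ''Q'', ''g'', ''gh'', ''gx'', ''gy'', ''h'', ''x'', ''y''}"
  "nvars grow_prog \<subseteq> {''e'', ''lb'', ''T'', ''R''}"
  "nvars step_prog \<subseteq> {''e'', ''Q'', ''g'', ''gh'', ''gx'', ''gy'', ''h'', ''x'', ''y'', ''lb'', ''T'', ''R'', ''f''}"
  "nvars phase_init_prog \<subseteq> {''b'', ''e'', ''T'', ''R''}"
  "nvars phase_prog \<subseteq> {''e'', ''Q'', ''g'', ''gh'', ''gx'', ''gy'', ''h'', ''x'', ''y'', ''lb'', ''T'', ''R'', ''f'', ''b'', ''I'', ''t''}"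
  "nvars transversal_prog \<subseteq> {''e'', ''Q'', ''g'', ''gh'', ''gx'', ''gy'', ''h'', ''x'', ''y'', ''lb'', ''T'', ''R'', ''f'', ''b'', ''I'', ''t'', ''s''}"
  "nvars record_prog \<subseteq> {''e'', ''found'', ''S''}"
  by (simp_all add: prog_defs)

lemmas not_in_nvars [simp] = nvars_progs[THEN contra_subsetD]

lemma rvars_progs:
  "rvars net_prog \<subseteq> {}"
  "rvars init_prog \<subseteq> {''p''}"
  "rvars query_prog \<subseteq> {}"
  "rvars try_prog \<subseteq> {''D'', ''dl''}"
  "rvars scan_prog \<subseteq> {''D'', ''dl''}"
  "rvars grow_prog \<subseteq> {''p''}"
  "rvars step_prog \<subseteq> {''D'', ''dl'', ''p''}"
  "rvars phase_init_prog \<subseteq> {''p''}"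
  "rvars phase_prog \<subseteq> {''D'', ''dl'', ''p''}"
  "rvars transversal_prog \<subseteq> {''D'', ''dl'', ''p''}"
  "rvars record_prog \<subseteq> {''W'', ''best''}"
  by (simp_all add: prog_defs)

lemmas not_in_rvars [simp] = rvars_progs[THEN contra_subsetD]

section \<open>Correctness\<close>

locale center_instance = knapsack_matroid_instance "{..<n}" d \<I> w
  for n :: nat and d \<I> w +
  fixes k :: real
begin

text \<open>Weights read as \<open>0\<close> from index \<open>n\<close> on, so dummies need no
  special case when prices are computed.\<close>

definition input :: "state \<Rightarrow> bool" where
  "input s \<longleftrightarrow> nats s ''n'' [] = n \<and> nats s ''m'' [] = 2 * n \<and> nats s ''l'' [] = n + 1 \<and>
    (\<forall>i. reals s ''w'' [i] = (if i < n then w i else 0)) \<and>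
    (\<forall>i<n. \<forall>j<n. reals s ''d'' [i, j] = d i j) \<and> reals s ''k'' [] = k"

lemma input_run:
  assumes "{''n'', ''m'', ''l''} \<inter> nvars c = {}" "{''w'', ''d'', ''k''} \<inter> rvars c = {}"
  shows "input (run \<J> c s) = input s"
  using assms by (simp add: input_def nats_run reals_run)

lemma input_update:
  assumes "x \<notin> {''n'', ''m'', ''l''}"
  shows "input (nat_update x is a s) = input s"
  using assms by (auto simp: input_def)

lemma inputD:
  assumes "input s"
  shows "nats s ''n'' [] = n" "nats s ''m'' [] = 2 * n" "nats s ''l'' [] = Suc n"
    "reals s ''w'' [e] = (if e < n then w e else 0)" "reals s ''k'' [] = k"
    "i < n \<Longrightarrow> j < n \<Longrightarrow> reals s ''d'' [i, j] = d i j"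
  using assms by (auto simp: input_def)

text \<open>\<open>Indep\<close> sees every nonzero cell, so leftovers beyond the real points would
  falsify a query.\<close>

definition query_clean :: "state \<Rightarrow> bool" where
  "query_clean s \<longleftrightarrow> (\<forall>i\<ge>n. nats s ''Q'' [i] = 0)"

text \<open>The direct sum of the given matroid with the free matroid on the dummies.\<close>

definition ext_indep :: "nat set set" where
  "ext_indep = {Z. Z \<subseteq> {..<2 * n} \<and> Z \<inter> {..<n} \<in> \<I>}"

text \<open>For exchange, either \<open>A\<close> has fewer real points than \<open>B\<close> and
  exchange in \<open>\<I>\<close> applies, or \<open>B\<close> has a dummy that \<open>A\<close>
  lacks, and dummies can be added freely.\<close>

sublocale ext: matroid "{..<2 * n}" ext_indep
proof
  show "finite {..<2 * n}" by simp
  show "A \<in> ext_indep \<Longrightarrow> A \<subseteq> {..<2 * n}" for A by (simp add: ext_indep_def)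
  show "{} \<in> ext_indep" by (simp add: ext_indep_def empty_indep)
  show "A \<in> ext_indep \<Longrightarrow> B \<subseteq> A \<Longrightarrow> B \<in> ext_indep" for A B
    using indep_subset[of "A \<inter> {..<n}" "B \<inter> {..<n}"] by (auto simp: ext_indep_def)
  fix A B assume A: "A \<in> ext_indep" and B: "B \<in> ext_indep" and less: "card A < card B"
  have fin: "finite A" "finite B" using A B finite_subset by (auto simp: ext_indep_def)
  show "\<exists>x \<in> B - A. insert x A \<in> ext_indep"
  proof (cases "card (A \<inter> {..<n}) < card (B \<inter> {..<n})")
    case True
    then obtain x where x: "x \<in> B \<inter> {..<n} - A \<inter> {..<n}" "insert x (A \<inter> {..<n}) \<in> \<I>"
      using exchange[of "A \<inter> {..<n}" "B \<inter> {..<n}"] A B by (auto simp: ext_indep_def)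
    then have "insert x A \<inter> {..<n} \<in> \<I>" by simp
    then show ?thesis using x A B by (intro bexI[of _ x]) (auto simp: ext_indep_def)
  next
    case False
    have "card A = card (A \<inter> {..<n}) + card (A - {..<n})"
      "card B = card (B \<inter> {..<n}) + card (B - {..<n})"
      using fin by (simp_all add: card_Int_Diff)
    then have "\<not> B - {..<n} \<subseteq> A - {..<n}"
      using False less fin card_mono[of "A - {..<n}" "B - {..<n}"] by auto
    then obtain x where x: "x \<in> B" "x \<notin> A" "\<not> x < n" by auto
    then have "insert x A \<inter> {..<n} = A \<inter> {..<n}" by auto
    then show ?thesis using x A B by (intro bexI[of _ x]) (auto simp: ext_indep_def)
  qed
qed

section \<open>What the arrays of a state represent\<close>

definition ball_of :: "state \<Rightarrow> nat \<Rightarrow> nat" where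
  "ball_of s e = nats s ''b'' [e]"

definition price :: "state \<Rightarrow> nat \<Rightarrow> real" where
  "price s e = (if e < n then w e else 0) + reals s ''p'' [ball_of s e]"

definition reached :: "state \<Rightarrow> nat set" where
  "reached s = {h. h \<le> n \<and> nats s ''R'' [h] \<noteq> 0}"

definition hole_set :: "state \<Rightarrow> nat \<Rightarrow> nat set" where
  "hole_set s h = {e. e < 2 * n \<and> nats s ''T'' [h, e] \<noteq> 0}"

definition current :: "state \<Rightarrow> nat set" where
  "current s = {e. e < 2 * n \<and> nats s ''I'' [e] \<noteq> 0}"

lemma query_spec:
  assumes s: "input s" "query_clean s"
  defines "s' \<equiv> run \<I> query_prog s"
  shows "query_clean s'" "nats s ''y'' [] < 2 * n \<Longrightarrow> nats s ''x'' [] < 2 * n \<Longrightarrow> 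
    bval \<I> (Indep ''Q'') s' \<longleftrightarrow>
      insert (nats s ''x'' []) (hole_set s (nats s ''h'' []) - {nats s ''y'' []}) \<in> ext_indep"
proof -
  let ?s1 = "run \<I> (PFor ''e'' ''n'' (PNat ''Q'' [V ''e''] (At2 ''T'' (V ''h'') (V ''e'')))) s"
  note n = inputD(1)[OF s(1)]
  have inj: "inj (\<lambda>e::nat. [e])" by (auto simp: inj_def)
  have Q1: "nats ?s1 ''Q'' = (\<lambda>js. if js \<in> (\<lambda>e. [e]) ` {..<n}
      then nats s ''T'' [nats s ''h'' [], inv (\<lambda>e. [e]) js] else nats s ''Q'' js)"
    unfolding n[symmetric] by (rule run_fill_nat[OF _ inj]) auto
  then have Q: "nats ?s1 ''Q'' [e] = (if e < n then nats s ''T'' [nats s ''h'' [], e] else 0)" for e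
    using s(2) inv_f_f[OF inj, of e] by (auto simp: query_clean_def)
  have fr: "nats ?s1 z = nats s z" if "z \<notin> {''e'', ''Q''}" for z using that by (intro nats_run) auto
  have e: "nats s' ''Q'' [e] = (if e = nats s ''x'' [] \<and> e < n then 1 else
     if e = nats s ''y'' [] then 0 else if e < n then nats s ''T'' [nats s ''h'' [], e] else 0)" for e
  proof -
    have "nats s' ''Q'' = (let Q = nats ?s1 ''Q'';
        Q' = (if nats s ''y'' [] < n then Q([nats s ''y'' []] := 0) else Q) in
      if nats s ''x'' [] < n then Q'([nats s ''x'' []] := 1) else Q')"
      by (simp add: s'_def query_prog_def n fr Let_def)
    then show ?thesis by (auto simp: Let_def Q)
  qed
  show "query_clean s'" by (auto simp: query_clean_def e)
  assume "nats s ''y'' [] < 2 * n" "nats s ''x'' [] < 2 * n"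
  then have "represented_set s' ''Q'' =
      insert (nats s ''x'' []) (hole_set s (nats s ''h'' []) - {nats s ''y'' []}) \<inter> {..<n}"
    by (auto simp: represented_set_def e hole_set_def split: if_splits)
  moreover have "insert (nats s ''x'' []) (hole_set s (nats s ''h'' []) - {nats s ''y'' []}) \<subseteq> {..<2 * n}"
    using \<open>nats s ''x'' [] < 2 * n\<close> by (auto simp: hole_set_def)
  ultimately show "bval \<I> (Indep ''Q'') s' \<longleftrightarrow>
      insert (nats s ''x'' []) (hole_set s (nats s ''h'' []) - {nats s ''y'' []}) \<in> ext_indep"
    by (simp add: ext_indep_def)
qed

end

section \<open>Finding the cheapest swap\<close>

definition same_outside :: "vname set \<Rightarrow> vname set \<Rightarrow> state \<Rightarrow> state \<Rightarrow> bool" where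
  "same_outside N R s s' \<longleftrightarrow>
    (\<forall>z. z \<notin> N \<longrightarrow> nats s' z = nats s z) \<and> (\<forall>z. z \<notin> R \<longrightarrow> reals s' z = reals s z)"

lemma same_outsideD:
  assumes "same_outside N R s s'"
  shows "z \<notin> N \<Longrightarrow> nats s' z = nats s z" "z \<notin> R \<Longrightarrow> reals s' z = reals s z"
  using assms by (simp_all add: same_outside_def)

lemma same_outside_nat_update:
  assumes "same_outside N R s s'" "x \<in> N"
  shows "same_outside N R s (nat_update x is a s')"
  using assms by (auto simp: same_outside_def)

lemma same_outside_real_update:
  assumes "same_outside N R s s'" "x \<in> R"
  shows "same_outside N R s (real_update x is a s')"
  using assms by (auto simp: same_outside_def)

lemma same_outside_run:
  assumes "nvars c \<subseteq> N" "rvars c \<subseteq> R"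
  shows "same_outside N R s (run \<I> c s)"
  using assms by (auto simp: same_outside_def intro!: nats_run reals_run)

lemma same_outside_trans:
  assumes "same_outside N R s s'" "same_outside N R s' s''"
  shows "same_outside N R s s''"
  using assms by (simp add: same_outside_def)

context center_instance
begin

definition swap_cand :: "state \<Rightarrow> nat \<times> nat \<times> nat \<Rightarrow> bool" where
  "swap_cand s = (\<lambda>(h, x, y). h \<le> n \<and> x < 2 * n \<and> y < 2 * n \<and> nats s ''R'' [h] \<noteq> 0 \<and>
    ball_of s x = h \<and> nats s ''R'' [ball_of s y] = 0 \<and> y \<in> hole_set s h \<and>
    insert x (hole_set s h - {y}) \<in> ext_indep)"

text \<open>A running minimum over the triples in \<open>Z\<close>. With \<open>g = 0\<close> the
  remaining values carry no information.\<close>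

definition scan_result :: "state \<Rightarrow> (nat \<times> nat \<times> nat) set \<Rightarrow> nat \<Rightarrow> nat \<Rightarrow> nat \<Rightarrow> nat \<Rightarrow> real \<Rightarrow> bool"
  where
  "scan_result s Z g h x y \<delta> \<longleftrightarrow>
    (if g = 0 then \<forall>c \<in> Z. \<not> swap_cand s c
     else swap_cand s (h, x, y) \<and> \<delta> = price s x - price s y \<and>
       (\<forall>c \<in> Z. swap_cand s c \<longrightarrow> \<delta> \<le> price s (fst (snd c)) - price s (snd (snd c))))"

lemma scan_result_skip:
  assumes "scan_result s Z g h x y \<delta>"
    and "swap_cand s (h', x', y') \<Longrightarrow> g \<noteq> 0 \<and> \<delta> \<le> price s x' - price s y'"
  shows "scan_result s (insert (h', x', y') Z) g h x y \<delta>"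
  using assms unfolding scan_result_def by (cases "g = 0") auto

lemma scan_result_take:
  assumes "scan_result s Z g h x y \<delta>" and "swap_cand s (h', x', y')"
    and "g = 0 \<or> price s x' - price s y' < \<delta>"
  shows "scan_result s (insert (h', x', y') Z) 1 h' x' y' (price s x' - price s y')"
  using assms unfolding scan_result_def by (cases "g = 0") force+

abbreviation "scan_nats \<equiv> {''e'', ''Q'', ''g'', ''gh'', ''gx'', ''gy'', ''h'', ''x'', ''y''}"

text \<open>Candidates and prices are evaluated in the start state \<open>s\<close>; this is sound
  because the scan changes scratch variables only, as \<open>same_outside\<close> records.\<close>

definition best_swap :: "state \<Rightarrow> (nat \<times> nat \<times> nat) set \<Rightarrow> state \<Rightarrow> bool" where
  "best_swap s Z s' \<longleftrightarrow> input s' \<and> query_clean s' \<and>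
    same_outside scan_nats {''D'', ''dl''} s s' \<and>
    scan_result s Z (nats s' ''g'' []) (nats s' ''gh'' []) (nats s' ''gx'' []) (nats s' ''gy'' [])
      (reals s' ''dl'' [])"

lemma best_swap_update:
  assumes bs: "best_swap s Z s'" and x: "x \<in> {''e'', ''h'', ''x'', ''y''}"
  shows "best_swap s Z (nat_update x is a s')"
proof -
  have 1: "x \<notin> {''n'', ''m'', ''l''}" "x \<noteq> ''Q''" "x \<noteq> ''g''" "x \<noteq> ''gh''" "x \<noteq> ''gx''" "x \<noteq> ''gy''"
    "x \<in> scan_nats"
    using x by auto
  show ?thesis
    using bs 1(2-6) same_outside_nat_update[OF _ 1(7)] input_update[OF 1(1)]
    unfolding best_swap_def query_clean_def by simp
qed

lemma try_spec:
  assumes bs: "best_swap s Z s'" and hxy: "nats s' ''h'' [] = h" "nats s' ''x'' [] = x"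
    "nats s' ''y'' [] = y" "h \<le> n" "x < 2 * n" "y < 2 * n"
  shows "best_swap s (insert (h, x, y) Z) (run \<I> try_prog s')"
proof -
  have i: "input s'" "query_clean s'" and so: "same_outside scan_nats {''D'', ''dl''} s s'"
    and res: "scan_result s Z (nats s' ''g'' []) (nats s' ''gh'' []) (nats s' ''gx'' [])
      (nats s' ''gy'' []) (reals s' ''dl'' [])"
    using bs by (simp_all add: best_swap_def)
  note fr = same_outsideD(1)[OF so] and frr = same_outsideD(2)[OF so]
  have frb: "ball_of s' e = ball_of s e" and frh: "hole_set s' j = hole_set s j" for e j
    by (simp_all add: ball_of_def hole_set_def fr)
  let ?g1 = "h \<le> n \<and> x < 2 * n \<and> y < 2 * n \<and> nats s ''R'' [h] \<noteq> 0 \<and>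
    ball_of s x = h \<and> nats s ''R'' [ball_of s y] = 0 \<and> y \<in> hole_set s h"
  let ?q = "run \<I> query_prog s'"
  have q: "query_clean ?q" "bval \<I> (Indep ''Q'') ?q \<longleftrightarrow> insert x (hole_set s h - {y}) \<in> ext_indep"
    using query_spec[OF i] hxy by (simp_all add: frh)
  have iq: "input ?q" using i by (subst input_run) auto
  have qn: "nats ?q z = nats s' z" if "z \<notin> {''e'', ''Q''}" for z using that by (intro nats_run) auto
  have qr: "reals ?q z = reals s' z" for z by (intro reals_run) auto
  show ?thesis
  proof (cases ?g1)
    case False
    then have "run \<I> try_prog s' = s'"
      using hxy by (auto simp: try_prog_def fr ball_of_def hole_set_def)
    moreover have "\<not> swap_cand s (h, x, y)" using False by (auto simp: swap_cand_def)
    moreover have "scan_result s (insert (h, x, y) Z) (nats s' ''g'' []) (nats s' ''gh'' [])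
          (nats s' ''gx'' []) (nats s' ''gy'' []) (reals s' ''dl'' [])"
      using scan_result_skip[OF res] \<open>\<not> swap_cand s (h, x, y)\<close> by blast
    ultimately show ?thesis using i so by (simp add: best_swap_def)
  next
    case True
    let ?D = "price s x - price s y"
    let ?u = "real_update ''D'' [] ?D ?q"
    let ?v = "nat_update ''gy'' [] y (nat_update ''gx'' [] x (nat_update ''gh'' [] h
        (real_update ''dl'' [] ?D (nat_update ''g'' [] (Suc 0) ?u))))"
    have D: "rval (RMinus (RPlus (RRead ''w'' [V ''x'']) (RRead ''p'' [At ''b'' (V ''x'')]))
         (RPlus (RRead ''w'' [V ''y'']) (RRead ''p'' [At ''b'' (V ''y'')]))) ?q = ?D"
      using hxy by (simp add: qn qr frr price_def ball_of_def fr inputD(4)[OF i(1)] flip: frr)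
    have "run \<I> try_prog s' = (if bval \<I> (BAnd (Indep ''Q'')
           (BNot (BAnd (Pos (V ''g'')) (RLe (RRead ''dl'' []) (RRead ''D'' []))))) ?u then ?v else ?u)"
      using hxy True D
      by (simp add: try_prog_def fr ball_of_def hole_set_def qn del: rval.simps)
        (auto simp: qn)
    moreover have "represented_set ?u ''Q'' = represented_set ?q ''Q''"
      by (simp add: represented_set_def)
    then have "bval \<I> (Indep ''Q'') ?u \<longleftrightarrow> swap_cand s (h, x, y)"
      using q(2) True by (simp add: swap_cand_def)
    ultimately have r: "run \<I> try_prog s' = (if swap_cand s (h, x, y) \<and>
        \<not> (nats s' ''g'' [] \<noteq> 0 \<and> reals s' ''dl'' [] \<le> ?D) then ?v else ?u)"
      by (auto simp: qn qr)
    have iu: "input ?u" "input ?v" using iq by (simp_all add: input_def)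
    have cu: "query_clean ?u" "query_clean ?v" using q(1) by (simp_all add: query_clean_def)
    have "same_outside scan_nats {''D'', ''dl''} s' ?q"
      using nvars_progs rvars_progs by (intro same_outside_run) auto
    then have "same_outside scan_nats {''D'', ''dl''} s ?q" using so by (rule same_outside_trans[rotated])
    then have so': "same_outside scan_nats {''D'', ''dl''} s ?u" "same_outside scan_nats {''D'', ''dl''} s ?v"
      by (simp_all add: same_outside_real_update same_outside_nat_update)
    show ?thesis
    proof (cases "swap_cand s (h, x, y) \<and> \<not> (nats s' ''g'' [] \<noteq> 0 \<and> reals s' ''dl'' [] \<le> ?D)")
      case c: True
      then have "scan_result s (insert (h, x, y) Z) 1 h x y ?D"
        using scan_result_take[OF res] by auto
      then show ?thesis using c iu cu so' unfolding r best_swap_def by simp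
    next
      case c: False
      then have "scan_result s (insert (h, x, y) Z) (nats s' ''g'' []) (nats s' ''gh'' [])
          (nats s' ''gx'' []) (nats s' ''gy'' []) (reals s' ''dl'' [])"
        using scan_result_skip[OF res] by auto
      then have "best_swap s (insert (h, x, y) Z) ?u"
        using iu cu so' unfolding best_swap_def by (simp add: qn qr)
      then show ?thesis using c unfolding r by (simp only: if_False)
    qed
  qed
qed

lemma scan_spec:
  assumes s: "input s" "query_clean s"
  shows "best_swap s {(h, x, y). h \<le> n \<and> x < 2 * n \<and> y < 2 * n} (run \<I> scan_prog s)"
proof -
  let ?s0 = "nat_update ''g'' [] 0 s"
  have m: "input s' \<Longrightarrow> nats s' ''m'' [] = 2 * n" for s' by (simp add: input_def)
  have bi: "best_swap s Z s' \<Longrightarrow> input s'" for Z s' by (simp add: best_swap_def)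
  have 0: "best_swap s {} ?s0"
    using s by (simp add: best_swap_def input_update query_clean_def scan_result_def same_outside_def)
  \<comment> \<open>The examined triples form an initial segment of the lexicographic order:
    \<open>?Z\<close> counts finished values of \<open>h\<close>, \<open>?Y\<close> also finished
    values of \<open>x\<close>, \<open>?X\<close> also finished values of \<open>y\<close>.\<close>
  let ?Z = "\<lambda>h. {c :: nat \<times> nat \<times> nat. fst c < h \<and> fst (snd c) < 2 * n \<and> snd (snd c) < 2 * n}"
  let ?Y = "\<lambda>h x. ?Z h \<union> {c. fst c = h \<and> fst (snd c) < x \<and> snd (snd c) < 2 * n}"
  let ?X = "\<lambda>h x y. ?Y h x \<union> {c. fst c = h \<and> fst (snd c) = x \<and> snd (snd c) < y}"
  have inner: "best_swap s (?Y h (Suc x)) (run \<I> (PFor ''y'' ''m'' try_prog) s')"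
    if bs: "best_swap s (?Y h x) s'" and hx: "nats s' ''h'' [] = h" "nats s' ''x'' [] = x" "h \<le> n" "x < 2 * n"
    for h x s'
  proof -
    let ?P = "\<lambda>y s''. best_swap s (?X h x y) s'' \<and> nats s'' ''h'' [] = h \<and> nats s'' ''x'' [] = x"
    have "?P (nats s' ''m'' []) (run \<I> (PFor ''y'' ''m'' try_prog) s')"
    proof (rule run_PFor[where P = ?P])
      show "?P 0 (nat_update ''y'' [] 0 s')" using bs hx by (simp add: best_swap_update)
      fix y s'' assume y: "y < nats s' ''m'' []" "nats s'' ''y'' [] = y" and P: "?P y s''"
      have "best_swap s (insert (h, x, y) (?X h x y)) (run \<I> try_prog s'')"
        using P y hx m[OF bi[OF bs]] by (intro try_spec) auto
      moreover have "insert (h, x, y) (?X h x y) = ?X h x (Suc y)" by (auto simp: less_Suc_eq)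
      ultimately show "?P (Suc y) (nat_update ''y'' [] (Suc y) (run \<I> try_prog s''))"
        using P by (simp add: best_swap_update nats_run)
    qed
    moreover have "?X h x (2 * n) = ?Y h (Suc x)" by (auto simp: less_Suc_eq)
    ultimately show ?thesis using m[OF bi[OF bs]] by simp
  qed
  have mid: "best_swap s (?Z (Suc h)) (run \<I> (PFor ''x'' ''m'' (PFor ''y'' ''m'' try_prog)) s')"
    if bs: "best_swap s (?Z h) s'" and hx: "nats s' ''h'' [] = h" "h \<le> n"
    for h s'
  proof -
    let ?P = "\<lambda>x s''. best_swap s (?Y h x) s'' \<and> nats s'' ''h'' [] = h"
    have "?P (nats s' ''m'' []) (run \<I> (PFor ''x'' ''m'' (PFor ''y'' ''m'' try_prog)) s')"
    proof (rule run_PFor[where P = ?P])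
      show "?P 0 (nat_update ''x'' [] 0 s')" using bs hx by (simp add: best_swap_update)
      fix x s'' assume x: "x < nats s' ''m'' []" "nats s'' ''x'' [] = x" and P: "?P x s''"
      have "best_swap s (?Y h (Suc x)) (run \<I> (PFor ''y'' ''m'' try_prog) s'')"
        using P x hx m[OF bi[OF bs]] by (intro inner) auto
      then show "?P (Suc x) (nat_update ''x'' [] (Suc x) (run \<I> (PFor ''y'' ''m'' try_prog) s''))"
        using P nats_run[of "''h''" "PFor ''y'' ''m'' try_prog" \<I> s''] by (simp add: best_swap_update)
    qed
    moreover have "?Y h (2 * n) = ?Z (Suc h)" by (auto simp: less_Suc_eq)
    ultimately show ?thesis using m[OF bi[OF bs]] by simp
  qed
  let ?P = "\<lambda>h s''. best_swap s (?Z h) s''"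
  have "?P (nats ?s0 ''l'' []) (run \<I> (PFor ''h'' ''l'' (PFor ''x'' ''m'' (PFor ''y'' ''m'' try_prog))) ?s0)"
  proof (rule run_PFor[where P = ?P])
    show "?P 0 (nat_update ''h'' [] 0 ?s0)" using 0 by (simp add: best_swap_update)
    fix h s'' assume h: "h < nats ?s0 ''l'' []" "nats s'' ''h'' [] = h" and P: "?P h s''"
    have "best_swap s (?Z (Suc h)) (run \<I> (PFor ''x'' ''m'' (PFor ''y'' ''m'' try_prog)) s'')"
      using P h inputD(3)[OF s(1)] by (intro mid) auto
    then show "?P (Suc h) (nat_update ''h'' [] (Suc h) (run \<I> (PFor ''x'' ''m'' (PFor ''y'' ''m'' try_prog)) s''))"
      by (simp add: best_swap_update)
  qed
  moreover have "?Z (Suc n) = {(h, x, y). h \<le> n \<and> x < 2 * n \<and> y < 2 * n}" by auto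
  ultimately show ?thesis using inputD(3)[OF s(1)] by (simp add: scan_prog_def)
qed

end

lemma image_pair_iff: "[a, e] \<in> (\<lambda>e. [l, e]) ` A \<longleftrightarrow> a = l \<and> e \<in> A"
  by auto

lemma inj_single: "inj (\<lambda>e::nat. [e])" and inj_pair: "inj (\<lambda>e::nat. [l, e])"
  by (auto simp: inj_def)

context center_instance
begin

section \<open>One step of the search\<close>

lemma grow_prices:
  assumes s: "input s"
  shows "reals (run \<I> (PFor ''e'' ''l'' (PIf (Pos (At ''R'' (V ''e'')))
      (PReal ''p'' [V ''e''] (RMinus (RRead ''p'' [V ''e'']) (RRead ''dl'' []))) PSkip)) s) ''p'' [j] =
    (if j \<in> reached s then reals s ''p'' [j] - reals s ''dl'' [] else reals s ''p'' [j])"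
    (is "reals ?s' _ _ = _")
proof -
  let ?P = "\<lambda>i s'. same_outside {''e''} {''p''} s s' \<and> (\<forall>j. reals s' ''p'' [j] =
    (if j < i \<and> nats s ''R'' [j] \<noteq> 0 then reals s ''p'' [j] - reals s ''dl'' [] else reals s ''p'' [j]))"
  have "?P (nats s ''l'' []) ?s'"
  proof (rule run_PFor[where P = ?P])
    show "?P 0 (nat_update ''e'' [] 0 s)" by (simp add: same_outside_def)
    fix i and s' :: state assume i: "nats s' ''e'' [] = i" and P: "?P i s'"
    have fr: "z \<noteq> ''e'' \<Longrightarrow> nats s' z = nats s z" "z \<noteq> ''p'' \<Longrightarrow> reals s' z = reals s z" for z
      using P by (simp_all add: same_outside_def)
    show "?P (Suc i) (nat_update ''e'' [] (Suc i) (run \<I> (PIf (Pos (At ''R'' (V ''e'')))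
      (PReal ''p'' [V ''e''] (RMinus (RRead ''p'' [V ''e'']) (RRead ''dl'' []))) PSkip) s'))"
      using P i by (auto simp: same_outside_def fr less_Suc_eq)
  qed
  then show ?thesis using inputD(3)[OF s] by (auto simp: reached_def less_Suc_eq_le)
qed

lemma grow_spec:
  assumes s: "input s" and hxy: "nats s ''gh'' [] = h" "nats s ''gx'' [] = x" "nats s ''gy'' [] = y"
    and l: "ball_of s y \<noteq> h" "ball_of s y \<le> n" "x < 2 * n" "x \<noteq> y"
  defines "s' \<equiv> run \<I> grow_prog s"
  shows "ball_of s' = ball_of s"
    "price s' e = (if ball_of s e \<in> reached s then price s e - reals s ''dl'' [] else price s e)"
    "reached s' = insert (ball_of s y) (reached s)"
    "hole_set s' = (hole_set s)(ball_of s y := insert x (hole_set s h - {y}))"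
proof -
  let ?c1 = "PFor ''e'' ''l'' (PIf (Pos (At ''R'' (V ''e'')))
      (PReal ''p'' [V ''e''] (RMinus (RRead ''p'' [V ''e'']) (RRead ''dl'' []))) PSkip)"
  let ?c2 = "PFor ''e'' ''m'' (PNat ''T'' [V ''lb'', V ''e''] (At2 ''T'' (V ''gh'') (V ''e'')))"
  let ?s1 = "run \<I> ?c1 s"
  let ?s2 = "nat_update ''lb'' [] (ball_of s y) ?s1"
  let ?s3 = "run \<I> ?c2 ?s2"
  let ?l = "ball_of s y"
  have n1: "nats ?s1 z = nats s z" if "z \<noteq> ''e''" for z using that by (intro nats_run) auto
  have r1: "reals ?s1 z = reals s z" if "z \<noteq> ''p''" for z using that by (intro reals_run) auto
  have n3: "nats ?s3 z = nats ?s2 z" if "z \<noteq> ''e''" "z \<noteq> ''T''" for z using that by (intro nats_run) auto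
  have r3: "reals ?s3 = reals ?s1" by (auto intro!: ext simp: reals_run)
  have m: "nats ?s2 ''m'' [] = 2 * n" using inputD(2)[OF s] by (simp add: n1)
  have "nats ?s3 ''T'' = (\<lambda>js. if js \<in> (\<lambda>e. [?l, e]) ` {..<nats ?s2 ''m'' []}
    then nats s ''T'' [h, inv (\<lambda>e. [?l, e]) js] else nats ?s2 ''T'' js)"
  proof (rule run_fill_nat[OF _ inj_pair])
    fix s' :: state and i assume i: "i < nats ?s2 ''m'' []" "nats s' ''e'' [] = i"
      and fr: "\<And>z. z \<noteq> ''e'' \<Longrightarrow> z \<noteq> ''T'' \<Longrightarrow> nats s' z = nats ?s2 z"
      and T: "\<And>js. js \<notin> (\<lambda>e. [?l, e]) ` {..<nats ?s2 ''m'' []} \<Longrightarrow> nats s' ''T'' js = nats ?s2 ''T'' js"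
    \<comment> \<open>The source row differs from the target row, so the cells copied so far have
      not disturbed it.\<close>
    have "nats s' ''T'' [h, i] = nats s ''T'' [h, i]"
      using T[of "[h, i]"] l(1) by (auto simp: n1)
    then show "map (\<lambda>e. nval e s') [V ''lb'', V ''e''] = [?l, i] \<and>
        nval (At2 ''T'' (V ''gh'') (V ''e'')) s' = nats s ''T'' [h, i]"
      using i by (simp add: fr n1 hxy)
  qed simp
  then have T3: "nats ?s3 ''T'' [j, e] = (if j = ?l \<and> e < 2 * n then nats s ''T'' [h, e]
      else nats s ''T'' [j, e])" for j e
    using inv_f_f[OF inj_pair[of ?l], of e]
    by (auto simp: m n1 image_pair_iff inputD(2)[OF s])
  have s': "s' = nat_update ''R'' [?l] 1 (nat_update ''T'' [?l, x] 1 (nat_update ''T'' [?l, y] 0 ?s3))"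
    by (simp add: s'_def grow_prog_def n1 n3 hxy flip: ball_of_def)
  have "nats s' ''b'' = nats s ''b''" unfolding s'_def by (rule nats_run) simp
  then show b: "ball_of s' = ball_of s" by (simp add: ball_of_def fun_eq_iff)
  have rs: "reals s' = reals ?s1" by (simp add: s' r3)
  have R': "nats s' ''R'' = (nats s ''R'')([?l] := 1)" by (simp add: s' n1 n3)
  show "price s' e = (if ball_of s e \<in> reached s then price s e - reals s ''dl'' [] else price s e)"
    unfolding price_def b using grow_prices[OF s] by (simp add: rs r1)
  show "reached s' = insert ?l (reached s)"
    using l(2) by (auto simp: R' reached_def)
  have T': "nats s' ''T'' [j, e] = (if j = ?l \<and> e = x then 1 else if j = ?l \<and> e = y then 0
      else if j = ?l \<and> e < 2 * n then nats s ''T'' [h, e] else nats s ''T'' [j, e])" for j e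
    using l(4) by (simp add: s' T3)
  have "hole_set s' j = ((hole_set s)(?l := insert x (hole_set s h - {y}))) j" for j
    using l(3,4) unfolding hole_set_def by (auto simp: T')
  then show "hole_set s' = (hole_set s)(?l := insert x (hole_set s h - {y}))" by blast
qed

abbreviation searching :: "nat \<Rightarrow> state \<Rightarrow> bool" where
  "searching \<sigma> s \<equiv>
    ext.hole_search (ball_of s) {..n} \<sigma> (price s) (reached s) (hole_set s)"

abbreviation no_transversal :: "(nat \<Rightarrow> nat) \<Rightarrow> bool" where
  "no_transversal b \<equiv> \<not> (\<exists>Z \<in> ext_indep. bij_betw b Z {..<n})"

lemma scan_cong:
  assumes "same_outside scan_nats {''D'', ''dl''} s s'"
  shows "ball_of s' = ball_of s" "price s' = price s" "reached s' = reached s"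
    "hole_set s' = hole_set s" "nats s' ''f'' = nats s ''f''"
  using same_outsideD[OF assms] by (simp_all add: ball_of_def price_def reached_def hole_set_def fun_eq_iff)

lemma step_spec:
  assumes s: "input s" "query_clean s" "nats s ''f'' [] = 0" "searching \<sigma> s" "n \<notin> reached s"
  defines "s' \<equiv> run \<I> step_prog s"
  shows "input s'" "query_clean s'" "ball_of s' = ball_of s"
    "if nats s' ''f'' [] = 0 then searching \<sigma> s' \<and> card (reached s') = Suc (card (reached s))
     else no_transversal (ball_of s)"
proof -
  let ?s1 = "run \<I> scan_prog s"
  have bs: "best_swap s {(h, x, y). h \<le> n \<and> x < 2 * n \<and> y < 2 * n} ?s1"
    using s by (intro scan_spec)
  then have i1: "input ?s1" "query_clean ?s1" and so: "same_outside scan_nats {''D'', ''dl''} s ?s1"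
    and res: "scan_result s {(h, x, y). h \<le> n \<and> x < 2 * n \<and> y < 2 * n} (nats ?s1 ''g'' [])
      (nats ?s1 ''gh'' []) (nats ?s1 ''gx'' []) (nats ?s1 ''gy'' []) (reals ?s1 ''dl'' [])"
    by (simp_all add: best_swap_def)
  note c = scan_cong[OF so]
  show "input s'" unfolding s'_def using s(1) by (subst input_run) auto
  have bij: "bij_betw (ball_of s) (hole_set s h) ({..n} - {h})" if "h \<in> reached s" for h
    using s(4) that by (simp add: ext.hole_search_def)
  \<comment> \<open>A raw cell of \<open>R\<close> tells something about \<open>reached\<close> only
    for balls up to \<open>n\<close>; for elements of \<open>hole_set s h\<close> the bijection
    provides this bound.\<close>
  have cand: "swap_cand s (h, x, y) \<longleftrightarrow> h \<in> reached s \<and> x < 2 * n \<and> ball_of s x = h \<and>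
      y \<in> hole_set s h \<and> ball_of s y \<notin> reached s \<and> insert x (hole_set s h - {y}) \<in> ext_indep" for h x y
  proof -
    have "y \<in> hole_set s h \<Longrightarrow> h \<in> reached s \<Longrightarrow> ball_of s y \<le> n"
      using bij[of h] by (auto simp: bij_betw_def)
    moreover have "y \<in> hole_set s h \<Longrightarrow> y < 2 * n" by (simp add: hole_set_def)
    moreover have "h \<in> reached s \<longleftrightarrow> h \<le> n \<and> nats s ''R'' [h] \<noteq> 0" for h by (simp add: reached_def)
    ultimately show ?thesis unfolding swap_cand_def by auto
  qed
  show "query_clean s'" "ball_of s' = ball_of s"
    "if nats s' ''f'' [] = 0 then searching \<sigma> s' \<and> card (reached s') = Suc (card (reached s))
     else no_transversal (ball_of s)"
  proof (atomize (full), cases "nats ?s1 ''g'' [] = 0")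
    case True
    then have s': "s' = nat_update ''f'' [] 1 ?s1" by (simp add: s'_def step_prog_def)
    have none: "\<not> swap_cand s (h, x, y)" if "h \<le> n" "x < 2 * n" "y < 2 * n" for h x y
      using res True that by (auto simp: scan_result_def)
    have "no_transversal (ball_of s)"
    proof -
      \<comment> \<open>With \<open>t = n\<close> the obstruction concerns exactly the balls that
        remain without the additional one.\<close>
      have "\<not> (\<exists>Z \<in> ext_indep. bij_betw (ball_of s) Z ({..n} - {n}))"
      proof (rule ext.hole_search_stuck[OF s(4)])
        show "n \<in> {..n} - reached s" using s(5) by simp
        fix h x y assume a: "h \<in> reached s" "x \<in> {..<2 * n}" "ball_of s x = h" "y \<in> hole_set s h"
          "ball_of s y \<notin> reached s"
        then have "\<not> swap_cand s (h, x, y)" by (intro none) (auto simp: reached_def hole_set_def)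
        with a show "insert x (hole_set s h - {y}) \<notin> ext_indep" by (simp add: cand)
      qed
      moreover have "{..n} - {n} = {..<n}" by auto
      ultimately show ?thesis by simp
    qed
    moreover have "query_clean s'" using i1 by (simp add: s' query_clean_def)
    moreover have "ball_of s' = ball_of s" unfolding c(1)[symmetric] by (simp add: s' ball_of_def fun_eq_iff)
    ultimately show "query_clean s' \<and> ball_of s' = ball_of s \<and>
      (if nats s' ''f'' [] = 0 then searching \<sigma> s' \<and> card (reached s') = Suc (card (reached s))
       else no_transversal (ball_of s))" by (simp add: s')
  next
    case False
    let ?h = "nats ?s1 ''gh'' []" and ?x = "nats ?s1 ''gx'' []" and ?y = "nats ?s1 ''gy'' []"
    from False have s': "s' = run \<I> grow_prog ?s1" by (simp add: s'_def step_prog_def)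
    have sc: "swap_cand s (?h, ?x, ?y)" and dl: "reals ?s1 ''dl'' [] = price s ?x - price s ?y"
      and best: "\<And>h x y. h \<le> n \<Longrightarrow> x < 2 * n \<Longrightarrow> y < 2 * n \<Longrightarrow> swap_cand s (h, x, y) \<Longrightarrow>
        price s ?x - price s ?y \<le> price s x - price s y"
      using res False by (auto simp: scan_result_def)
    note h = sc[unfolded cand]
    have byn: "ball_of s ?y \<le> n" using bij[of ?h] h by (auto simp: bij_betw_def)
    have "ball_of s ?y \<noteq> ?h" "?x \<noteq> ?y" using h by auto
    note g = grow_spec[OF i1(1) refl refl refl, unfolded c, OF this(1) byn _ this(2), folded s']
    have g': "ball_of s' = ball_of s"
      "\<And>e. price s' e = (if ball_of s e \<in> reached s then price s e - (price s ?x - price s ?y) else price s e)"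
      "reached s' = insert (ball_of s ?y) (reached s)"
      "hole_set s' = (hole_set s)(ball_of s ?y := insert ?x (hole_set s ?h - {?y}))"
      using g h dl by auto
    have "ext.hole_search (ball_of s) {..n} \<sigma> (price s') (insert (ball_of s ?y) (reached s))
      ((hole_set s)(ball_of s ?y := insert ?x (hole_set s ?h - {?y})))"
    proof (rule ext.hole_search_step[OF s(4)])
      fix h x y assume a: "h \<in> reached s" "x \<in> {..<2 * n}" "ball_of s x = h" "y \<in> hole_set s h"
        "ball_of s y \<notin> reached s" "insert x (hole_set s h - {y}) \<in> ext_indep"
      then show "price s ?x - price s ?y \<le> price s x - price s y"
        by (intro best[of h]) (auto simp: cand, auto simp: reached_def hole_set_def)
    qed (use h g'(2) in auto)
    then have "searching \<sigma> s'" by (simp only: g')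
    moreover have "card (reached s') = Suc (card (reached s))"
    proof -
      have "finite (reached s)" by (simp add: reached_def)
      then show ?thesis unfolding g'(3) using h by simp
    qed
    moreover have "nats s' ''f'' [] = 0" using s(3) c(5) by (simp add: s' nats_run)
    moreover have "query_clean s'" using i1(2) by (simp add: s' query_clean_def nats_run)
    ultimately show "query_clean s' \<and> ball_of s' = ball_of s \<and>
      (if nats s' ''f'' [] = 0 then searching \<sigma> s' \<and> card (reached s') = Suc (card (reached s))
       else no_transversal (ball_of s))" using g'(1) by simp
  qed
qed

section \<open>One phase: withdrawing a dummy\<close>

lemma phase_init_spec:
  assumes s: "input s" and \<sigma>: "nats s ''s'' [] = \<sigma>" "\<sigma> < n"
  defines "s' \<equiv> run \<I> phase_init_prog s"
  shows "ball_of s' = (ball_of s)(n + \<sigma> := n)" "reached s' = {\<sigma>}" "hole_set s' \<sigma> = current s"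
    "reals s' ''p'' [j] = (if j = n then reals s ''p'' [\<sigma>] else reals s ''p'' [j])"
proof -
  let ?c1 = "PFor ''e'' ''l'' (PNat ''R'' [V ''e''] (NConst 0))"
  let ?c2 = "PFor ''e'' ''m'' (PNat ''T'' [V ''s'', V ''e''] (At ''I'' (V ''e'')))"
  let ?s0 = "real_update ''p'' [n] (reals s ''p'' [\<sigma>]) (nat_update ''b'' [n + \<sigma>] n s)"
  let ?s1 = "run \<I> ?c1 ?s0"
  let ?s2 = "nat_update ''R'' [\<sigma>] 1 ?s1"
  have n1: "nats ?s1 z = nats ?s0 z" if "z \<noteq> ''e''" "z \<noteq> ''R''" for z
    using that by (intro nats_run) auto
  have s': "s' = run \<I> ?c2 ?s2"
    by (simp add: s'_def phase_init_prog_def inputD[OF s] \<sigma> n1)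
  have n2: "nats s' z = nats ?s2 z" if "z \<noteq> ''e''" "z \<noteq> ''T''" for z
    unfolding s' using that by (intro nats_run) auto
  have l: "nats ?s0 ''l'' [] = Suc n" "nats ?s2 ''m'' [] = 2 * n"
    using inputD[OF s] by (simp_all add: n1)
  have "nats ?s1 ''R'' = (\<lambda>js. if js \<in> (\<lambda>e. [e]) ` {..<nats ?s0 ''l'' []} then 0 else nats ?s0 ''R'' js)"
    by (rule run_fill_nat[OF _ inj_single, where f = "\<lambda>_. 0"]) simp_all
  then have R: "nats s' ''R'' [j] = (if j = \<sigma> then 1 else if j \<le> n then 0 else nats s ''R'' [j])" for j
    by (auto simp: n2 less_Suc_eq_le inputD(3)[OF s])
  then show "reached s' = {\<sigma>}" using \<sigma>(2) by (auto simp: reached_def)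
  have "nats s' ''T'' = (\<lambda>js. if js \<in> (\<lambda>e. [\<sigma>, e]) ` {..<nats ?s2 ''m'' []}
    then nats s ''I'' [inv (\<lambda>e. [\<sigma>, e]) js] else nats ?s2 ''T'' js)"
    unfolding s'
  proof (rule run_fill_nat[OF _ inj_pair])
    fix s' :: state and i assume i: "i < nats ?s2 ''m'' []" "nats s' ''e'' [] = i"
      and fr: "\<And>z. z \<noteq> ''e'' \<Longrightarrow> z \<noteq> ''T'' \<Longrightarrow> nats s' z = nats ?s2 z"
    show "map (\<lambda>e. nval e s') [V ''s'', V ''e''] = [\<sigma>, i] \<and>
        nval (At ''I'' (V ''e'')) s' = nats s ''I'' [i]"
      using i \<sigma> by (simp add: fr n1)
  qed simp
  then have "nats s' ''T'' [\<sigma>, e] = nats s ''I'' [e]" if "e < 2 * n" for e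
    using inv_f_f[OF inj_pair[of \<sigma>], of e] that by (auto simp: l n1 image_pair_iff inputD(2)[OF s])
  then show "hole_set s' \<sigma> = current s" by (auto simp: hole_set_def current_def)
  show "ball_of s' = (ball_of s)(n + \<sigma> := n)"
    by (simp add: ball_of_def n1 n2 fun_eq_iff)
  have "reals s' ''p'' = reals ?s0 ''p''" unfolding s' by (simp add: reals_run)
  then show "reals s' ''p'' [j] = (if j = n then reals s ''p'' [\<sigma>] else reals s ''p'' [j])" by simp
qed

abbreviation active :: "(nat \<Rightarrow> nat) \<Rightarrow> nat set" where
  "active b \<equiv> {e \<in> {..<2 * n}. b e \<in> {..<n}}"

text \<open>Minimality ranges over all independent sets of this size among the active elements, not
  only over transversals; this is the form in which a search starts and ends.\<close>

definition best_transversal :: "state \<Rightarrow> bool" where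
  "best_transversal s \<longleftrightarrow> ext.min_indep (price s) (active (ball_of s)) (current s) \<and>
    bij_betw (ball_of s) (current s) {..<n}"

lemma min_indep_cong:
  assumes "ext.min_indep q U S" "U' \<subseteq> U" "S \<subseteq> U'" "\<And>e. e \<in> U' \<Longrightarrow> q' e = q e"
  shows "ext.min_indep q' U' S"
proof -
  have "sum q' T = sum q T" if "T \<subseteq> U'" for T
    using that by (intro sum.cong) (auto intro: assms(4))
  then show ?thesis using assms(1-3) by (auto simp: ext.min_indep_def)
qed

lemma phase_search:
  assumes s: "input s" "query_clean s" "nats s ''f'' [] = 0" "searching \<sigma> s"
  defines "s' \<equiv> run \<I> (PFor ''t'' ''n''
    (PIf (BAnd (Zero (At ''R'' (V ''n''))) (Zero (V ''f''))) step_prog PSkip)) s"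
  shows "input s'" "query_clean s'" "ball_of s' = ball_of s"
    "if nats s' ''f'' [] = 0 then searching \<sigma> s' \<and> n \<in> reached s' else no_transversal (ball_of s)"
proof -
  let ?c = "PIf (BAnd (Zero (At ''R'' (V ''n''))) (Zero (V ''f''))) step_prog PSkip"
  \<comment> \<open>Unless the search is over, more than \<open>i\<close> balls are reached after
    \<open>i\<close> steps.\<close>
  let ?P = "\<lambda>i s'. input s' \<and> query_clean s' \<and> ball_of s' = ball_of s \<and>
    (if nats s' ''f'' [] = 0 then searching \<sigma> s' \<and> (n \<in> reached s' \<or> i < card (reached s'))
     else no_transversal (ball_of s))"
  have upd: "input (nat_update ''t'' [] i s') = input s'"
    "query_clean (nat_update ''t'' [] i s') = query_clean s'"
    "ball_of (nat_update ''t'' [] i s') = ball_of s'" "price (nat_update ''t'' [] i s') = price s'"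
    "reached (nat_update ''t'' [] i s') = reached s'" "hole_set (nat_update ''t'' [] i s') = hole_set s'"
    for i s'
    by (simp_all add: input_update query_clean_def ball_of_def[abs_def] price_def[abs_def]
        reached_def hole_set_def[abs_def])
  have "?P (nats s ''n'' []) s'"
    unfolding s'_def
  proof (rule run_PFor[where P = ?P])
    have "0 < card (reached s)"
      using s(4) unfolding ext.hole_search_def by (auto simp: card_gt_0_iff reached_def)
    then show "?P 0 (nat_update ''t'' [] 0 s)" using s by (simp add: upd)
    fix i and s' :: state assume P: "?P i s'"
    have n: "nats s' ''n'' [] = n" using P inputD by blast
    show "?P (Suc i) (nat_update ''t'' [] (Suc i) (run \<I> ?c s'))"
    proof (cases "n \<notin> reached s' \<and> nats s' ''f'' [] = 0")
      case True
      then have "nats s' ''R'' [n] = 0" by (simp add: reached_def)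
      then have r: "run \<I> ?c s' = run \<I> step_prog s'" using True n by simp
      have pre: "input s'" "query_clean s'" "nats s' ''f'' [] = 0" "searching \<sigma> s'" "n \<notin> reached s'"
        using P True by auto
      show ?thesis unfolding r using step_spec[OF pre] P True by (auto simp: upd split: if_splits)
    next
      case False
      then have "run \<I> ?c s' = s'" using n by (auto simp: reached_def)
      then show ?thesis using P False by (auto simp: upd)
    qed
  qed
  then have P: "?P n s'" unfolding inputD(1)[OF s(1)] .
  \<comment> \<open>Without ball \<open>n\<close> there are only \<open>n\<close> balls to
    reach.\<close>
  have "n \<in> reached s'" if "n < card (reached s')"
  proof (rule ccontr)
    assume "n \<notin> reached s'"
    then have "reached s' \<subseteq> {..<n}" unfolding reached_def using le_neq_implies_less by blast
    then have "card (reached s') \<le> card {..<n}" by (rule card_mono[OF finite_lessThan])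
    with that show False by simp
  qed
  then show "input s'" "query_clean s'" "ball_of s' = ball_of s"
    "if nats s' ''f'' [] = 0 then searching \<sigma> s' \<and> n \<in> reached s' else no_transversal (ball_of s)"
    using P by (auto split: if_splits)
qed

text \<open>The current set is reinterpreted: once its dummy belongs to ball \<open>n\<close>, it is
  a minimal set with hole \<open>\<sigma>\<close> and starts the search. A set with hole
  \<open>n\<close> ends it and cannot contain that dummy.\<close>

lemma phase_spec:
  assumes s: "input s" "query_clean s" "nats s ''f'' [] = 0" "nats s ''s'' [] = \<sigma>" "\<sigma> < n"
    and \<sigma>: "n + \<sigma> \<in> current s" "ball_of s (n + \<sigma>) = \<sigma>"
    and balls: "\<And>e. e < 2 * n \<Longrightarrow> ball_of s e \<noteq> n"
    and best: "best_transversal s"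
  defines "s' \<equiv> run \<I> phase_prog s"
  shows "input s'" "query_clean s'" "ball_of s' = (ball_of s)(n + \<sigma> := n)"
    "if nats s' ''f'' [] = 0 then best_transversal s' else no_transversal (ball_of s')"
proof -
  let ?c1 = "PFor ''t'' ''n''
    (PIf (BAnd (Zero (At ''R'' (V ''n''))) (Zero (V ''f''))) step_prog PSkip)"
  let ?c2 = "PFor ''e'' ''m'' (PNat ''I'' [V ''e''] (At2 ''T'' (V ''n'') (V ''e'')))"
  let ?b = "(ball_of s)(n + \<sigma> := n)"
  define s0 where "s0 = run \<I> phase_init_prog s"
  define s1 where "s1 = run \<I> ?c1 s0"
  have s': "s' = run \<I> ?c2 s1" by (simp add: s'_def phase_prog_def s0_def s1_def)
  note pi = phase_init_spec[OF s(1,4,5), folded s0_def]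
  have i0: "input s0" unfolding s0_def using s(1) by (subst input_run) auto
  have c0: "query_clean s0" using s(2) by (simp add: s0_def query_clean_def nats_run)
  have f0: "nats s0 ''f'' [] = 0" using s(3) by (simp add: s0_def nats_run)
  have pr: "price s0 e = price s e" if "e < 2 * n" for e
    using balls[OF that] \<sigma>(2) by (simp add: price_def pi)
  \<comment> \<open>Ball \<open>n\<close> contains just the moved dummy, so admitting this ball
    leaves the universe as it was.\<close>
  have U: "{e \<in> {..<2 * n}. ?b e \<in> {..n}} = active (ball_of s)"
    using balls s(5) \<sigma>(2) by (auto simp: le_less)
  have mi: "ext.min_indep (price s) (active (ball_of s)) (current s)"
    and bij: "bij_betw (ball_of s) (current s) {..<n}"
    using best by (auto simp: best_transversal_def)
  have "ext.min_indep (price s0) {e \<in> {..<2 * n}. ?b e \<in> {..n}} (current s)"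
    unfolding U by (rule min_indep_cong[OF mi]) (use mi pr in \<open>auto simp: ext.min_indep_def\<close>)
  moreover have "bij_betw ?b (current s) ({..n} - {\<sigma>})"
  proof -
    have other: "ball_of s e \<noteq> \<sigma>" "ball_of s e < n" if "e \<in> current s" "e \<noteq> n + \<sigma>" for e
      using bij that \<sigma> by (auto simp: bij_betw_def inj_on_def)
    have "inj_on ?b (current s)"
      using bij other by (auto simp: bij_betw_def inj_on_def)
    moreover have "?b ` current s = {..n} - {\<sigma>}"
    proof
      show "?b ` current s \<subseteq> {..n} - {\<sigma>}" using other s(5) by (auto simp: le_less)
      show "{..n} - {\<sigma>} \<subseteq> ?b ` current s"
      proof
        fix j assume j: "j \<in> {..n} - {\<sigma>}"
        show "j \<in> ?b ` current s"
        proof (cases "j = n")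
          case True
          then show ?thesis using \<sigma>(1) by (intro image_eqI[of _ _ "n + \<sigma>"]) auto
        next
          case False
          then have "j \<in> ball_of s ` current s" using j bij by (auto simp: bij_betw_def)
          then obtain e where "e \<in> current s" "ball_of s e = j" by blast
          moreover from this have "e \<noteq> n + \<sigma>" using j \<sigma>(2) by auto
          ultimately show ?thesis by (intro image_eqI[of _ _ e]) auto
        qed
      qed
    qed
    ultimately show ?thesis by (simp add: bij_betw_def)
  qed
  ultimately have hs: "ext.hole_search ?b {..n} \<sigma> (price s0) {\<sigma>} (\<lambda>_. current s)"
    using s(5) by (intro ext.hole_search_init) auto
  have "ext.hole_search ?b {..n} \<sigma> (price s0) {\<sigma>} (hole_set s0)"
    by (rule ext.hole_search_cong[OF hs]) (simp_all add: pi)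
  then have "searching \<sigma> s0" by (simp only: pi)
  note ps = phase_search[OF i0 c0 f0 this, folded s1_def]
  show "input s'" unfolding s' using ps(1) by (subst input_run) auto
  show "query_clean s'" using ps(2) by (simp add: s' query_clean_def nats_run)
  have b': "ball_of s' = ball_of s1" by (simp add: s' ball_of_def nats_run fun_eq_iff)
  then show b'': "ball_of s' = ?b" using ps(3) pi(1) by simp
  have p': "price s' = price s1" 
  proof -
    have "reals s' ''p'' = reals s1 ''p''" unfolding s' by (rule reals_run) simp
    then show ?thesis by (simp add: price_def fun_eq_iff b')
  qed
  have m: "nats s1 ''m'' [] = 2 * n" using inputD(2)[OF ps(1)] .
  have "nats s' ''I'' = (\<lambda>js. if js \<in> (\<lambda>e. [e]) ` {..<nats s1 ''m'' []}
      then nats s1 ''T'' [n, inv (\<lambda>e. [e]) js] else nats s1 ''I'' js)"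
    unfolding s' by (rule run_fill_nat[OF _ inj_single]) (simp_all add: inputD(1)[OF ps(1)])
  then have "nats s' ''I'' [e] = nats s1 ''T'' [n, e]" if "e < 2 * n" for e
    using inv_f_f[OF inj_single, of e] that by (auto simp: m)
  then have cur: "current s' = hole_set s1 n" by (auto simp: current_def hole_set_def)
  have f': "nats s' ''f'' [] = nats s1 ''f'' []" by (simp add: s' nats_run)
  show "if nats s' ''f'' [] = 0 then best_transversal s' else no_transversal (ball_of s')"
  proof (cases "nats s' ''f'' [] = 0")
    case True
    then have "searching \<sigma> s1" "n \<in> reached s1" using ps(4) f' by auto
    then have h: "ext.min_indep (price s1) {e \<in> {..<2 * n}. ball_of s1 e \<in> {..n}} (hole_set s1 n)"
      "bij_betw (ball_of s1) (hole_set s1 n) ({..n} - {n})"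
      by (auto simp: ext.hole_search_def)
    have "{..n} - {n} = {..<n}" by auto
    then have bij': "bij_betw (ball_of s') (current s') {..<n}" using h(2) by (simp add: b' cur)
    have sub: "current s' \<subseteq> active (ball_of s')"
      using bij' by (auto simp: bij_betw_def current_def)
    \<comment> \<open>Dropping ball \<open>n\<close> shrinks the universe but keeps the chosen set
      inside it, so minimality is inherited.\<close>
    have "ext.min_indep (price s') (active (ball_of s')) (current s')"
      using h(1) sub unfolding b' p' cur by (intro min_indep_cong[OF h(1)]) auto
    then show ?thesis using bij' True by (simp add: best_transversal_def)
  next
    case False
    then show ?thesis using ps(3,4) f' b' by simp
  qed
qed

text \<open>The ball map once the dummies of all net points are retired, expressed through the state
  before \<open>transversal_prog\<close>.\<close>

definition final_ball :: "state \<Rightarrow> nat \<Rightarrow> nat" where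
  "final_ball s e = (if e < n then ball_of s e else if nats s ''c'' [e - n] \<noteq> 0 then n + 1 else e - n)"

text \<open>A failing phase shows that no transversal exists even with the dummies still available.
  Retiring more of them cannot help, so the later iterations may do nothing.\<close>

lemma transversal_spec:
  assumes s: "input s" "query_clean s" "nats s ''f'' [] = 0"
    and real_balls: "\<forall>e<n. ball_of s e < n \<or> ball_of s e = n + 1"
    and dummy_balls: "\<forall>e<n. ball_of s (n + e) = e"
    and best: "best_transversal s"
  defines "s' \<equiv> run \<I> transversal_prog s"
  shows "input s'" "query_clean s'"
    "if nats s' ''f'' [] = 0 then best_transversal s' \<and> (\<forall>e<2 * n. ball_of s' e = final_ball s e)
     else no_transversal (final_ball s)"
proof -
  have balls: "\<And>e. e < n \<Longrightarrow> ball_of s e < n \<or> ball_of s e = n + 1"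
      "\<And>e. e < n \<Longrightarrow> ball_of s (n + e) = e"
    using real_balls dummy_balls by auto
  let ?c = "PIf (BAnd (Pos (At ''c'' (V ''s''))) (Zero (V ''f'')))
      (PIf (Pos (At ''I'' (NPlus (V ''n'') (V ''s'')))) phase_prog PSkip ;;
       PNat ''b'' [NPlus (V ''n'') (V ''s'')] (V ''l''))
      PSkip"
  \<comment> \<open>The ball map after the dummies of net points below \<open>\<sigma>\<close> have
    been retired.\<close>
  let ?b = "\<lambda>\<sigma> e. if n \<le> e \<and> nats s ''c'' [e - n] \<noteq> 0 \<and> e - n < \<sigma> then n + 1 else ball_of s e"
  let ?P = "\<lambda>\<sigma> s'. input s' \<and> query_clean s' \<and> nats s' ''c'' = nats s ''c'' \<and>
    (if nats s' ''f'' [] = 0 then best_transversal s' \<and> (\<forall>e<2 * n. ball_of s' e = ?b \<sigma> e)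
     else no_transversal (final_ball s))"
  have upd: "input (nat_update ''s'' [] i s') = input s'"
    "query_clean (nat_update ''s'' [] i s') = query_clean s'"
    "ball_of (nat_update ''s'' [] i s') = ball_of s'"
    "best_transversal (nat_update ''s'' [] i s') = best_transversal s'" for i s'
    by (simp_all add: input_update query_clean_def ball_of_def[abs_def] best_transversal_def
        price_def[abs_def] current_def)
  have "?P (nats s ''n'' []) s'"
    unfolding s'_def transversal_prog_def
  proof (rule run_PFor[where P = ?P])
    show "?P 0 (nat_update ''s'' [] 0 s)" using s best by (simp add: upd)
    fix \<sigma> and s' :: state assume \<sigma>: "\<sigma> < nats s ''n'' []" "nats s' ''s'' [] = \<sigma>" and P: "?P \<sigma> s'"
    have \<sigma>n: "\<sigma> < n" using \<sigma>(1) inputD(1)[OF s(1)] by simp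
    have i': "input s'" "query_clean s'" using P by auto
    note nl = inputD(1,3)[OF i'(1)]
    show "?P (Suc \<sigma>) (nat_update ''s'' [] (Suc \<sigma>) (run \<I> ?c s'))"
    proof (cases "nats s' ''f'' [] = 0")
      case False
      then have "run \<I> ?c s' = s'" by simp
      then show ?thesis using P False by (simp add: upd)
    next
      case f: True
      then have bt: "best_transversal s'" and b: "\<And>e. e < 2 * n \<Longrightarrow> ball_of s' e = ?b \<sigma> e"
        using P by auto
      show ?thesis
      proof (cases "nats s ''c'' [\<sigma>] = 0")
        case True
        then have r: "run \<I> ?c s' = s'" using P \<sigma>(2) by simp
        have eq: "?b (Suc \<sigma>) e = ?b \<sigma> e" for e using True by (auto simp: less_Suc_eq)
        show ?thesis unfolding r eq upd using P by simp
      next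
        case c: False
        define s1 where "s1 = (if nats s' ''I'' [n + \<sigma>] = 0 then s' else run \<I> phase_prog s')"
        have n1: "nats s1 ''n'' [] = n" "nats s1 ''s'' [] = \<sigma>" "nats s1 ''l'' [] = Suc n"
          "nats s1 ''c'' = nats s ''c''"
          using nl \<sigma>(2) P by (simp_all add: s1_def nats_run)
        have r: "run \<I> ?c s' = nat_update ''b'' [n + \<sigma>] (Suc n) s1"
          using P f c \<sigma>(2) nl n1 by (auto simp: s1_def)
        let ?s2 = "nat_update ''b'' [n + \<sigma>] (Suc n) s1"
        have bs: "ball_of s' (n + \<sigma>) = \<sigma>" using b[of "n + \<sigma>"] balls(2)[OF \<sigma>n] \<sigma>n by simp
        have bne: "ball_of s' e \<noteq> n" if "e < 2 * n" for e
        proof (cases "e < n")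
          case True
          then show ?thesis using b[OF that] balls(1)[of e] by auto
        next
          case False
          then have "ball_of s e < n" using balls(2)[of "e - n"] that by simp
          then show ?thesis using b[OF that] by simp
        qed
        have b2: "ball_of (nat_update ''b'' [i] a s1) = (ball_of s1)(i := a)" for i a
          by (simp add: ball_of_def fun_eq_iff)
        \<comment> \<open>After success the dummy is outside the current set, whether or not a phase
          was run: a phase leaves the dummy in ball \<open>n\<close>, and the set meets only balls
          below \<open>n\<close>.\<close>
        have main: "input s1 \<and> query_clean s1 \<and> (\<forall>e. e \<noteq> n + \<sigma> \<longrightarrow> ball_of s1 e = ball_of s' e) \<and>
          (if nats s1 ''f'' [] = 0 then best_transversal s1 \<and> n + \<sigma> \<notin> current s1
           else no_transversal (ball_of s1) \<and> \<not> ball_of s1 (n + \<sigma>) < n)"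
        proof (cases "nats s' ''I'' [n + \<sigma>] = 0")
          case True
          then show ?thesis using i' f bt by (simp add: s1_def current_def)
        next
          case False
          then have "n + \<sigma> \<in> current s'" using \<sigma>n by (simp add: current_def)
          note ph = phase_spec[OF i' f \<sigma>(2) \<sigma>n this bs bne bt]
          have eq: "s1 = run \<I> phase_prog s'" using False by (simp add: s1_def)
          have "n + \<sigma> \<notin> current s1" if "best_transversal s1"
            using that ph(3) by (auto simp: eq best_transversal_def bij_betw_def)
          then show ?thesis using ph by (auto simp: eq split: if_splits)
        qed
        have i2: "input ?s2" "query_clean ?s2" using main by (auto simp: input_update query_clean_def)
        show ?thesis
        proof (cases "nats s1 ''f'' [] = 0")
          case True
          then have bt1: "best_transversal s1" and ns: "n + \<sigma> \<notin> current s1" using main by auto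
          have c2: "current ?s2 = current s1" by (simp add: current_def)
          have bij: "bij_betw (ball_of ?s2) (current s1) {..<n}"
          proof -
            have "bij_betw (ball_of s1) (current s1) {..<n}" using bt1 by (simp add: best_transversal_def)
            moreover have "bij_betw (ball_of ?s2) (current s1) {..<n} \<longleftrightarrow>
                bij_betw (ball_of s1) (current s1) {..<n}"
              by (rule bij_betw_cong) (use ns in \<open>auto simp: b2\<close>)
            ultimately show ?thesis by blast
          qed
          have "ext.min_indep (price ?s2) (active (ball_of ?s2)) (current s1)"
          proof (rule min_indep_cong)
            show "ext.min_indep (price s1) (active (ball_of s1)) (current s1)"
              using bt1 by (simp add: best_transversal_def)
            show "active (ball_of ?s2) \<subseteq> active (ball_of s1)" by (auto simp: b2)
            show "current s1 \<subseteq> active (ball_of ?s2)"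
              using bij by (auto simp: bij_betw_def current_def)
            show "price ?s2 e = price s1 e" if "e \<in> active (ball_of ?s2)" for e
              using that by (auto simp: price_def b2 split: if_splits)
          qed
          then have "best_transversal ?s2" using bij by (simp add: best_transversal_def c2)
          moreover have "\<forall>e<2 * n. ball_of ?s2 e = ?b (Suc \<sigma>) e"
          proof (intro allI impI)
            fix e assume e: "e < 2 * n"
            show "ball_of ?s2 e = ?b (Suc \<sigma>) e"
            proof (cases "e = n + \<sigma>")
              case True
              then show ?thesis using c by (simp add: b2)
            next
              case False
              then have "ball_of ?s2 e = ?b \<sigma> e" using main b[OF e] by (simp add: b2)
              then show ?thesis using False by (auto simp: less_Suc_eq)
            qed
          qed
          ultimately show ?thesis unfolding r using i2 n1 True by (simp add: upd)
        next
          case False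
          have "no_transversal (final_ball s)"
          proof
            assume "\<exists>Z \<in> ext_indep. bij_betw (final_ball s) Z {..<n}"
            then obtain Z where Z: "Z \<in> ext_indep" "bij_betw (final_ball s) Z {..<n}" by blast
            \<comment> \<open>\<open>Z\<close> avoids all dummies of net points, since
              \<open>final_ball\<close> sends them to \<open>n + 1\<close>; on its elements both
              maps agree.\<close>
            have "ball_of s1 e = final_ball s e" if "e \<in> Z" for e
            proof -
              have e: "e < 2 * n" "final_ball s e < n"
                using Z that ext.indep_subset_ground by (auto simp: bij_betw_def)
              then have "e \<noteq> n + \<sigma>" using c by (auto simp: final_ball_def)
              then have "ball_of s1 e = ?b \<sigma> e" using main b[OF e(1)] by simp
              also have "\<dots> = final_ball s e"
                using e balls(2)[of "e - n"] by (auto simp: final_ball_def split: if_splits)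
              finally show ?thesis .
            qed
            then have "bij_betw (ball_of s1) Z {..<n} \<longleftrightarrow> bij_betw (final_ball s) Z {..<n}"
              by (rule bij_betw_cong)
            then have "bij_betw (ball_of s1) Z {..<n}" using Z(2) by blast
            then show False using Z(1) main False by auto
          qed
          then show ?thesis unfolding r using i2 n1 False by (simp add: upd)
        qed
      qed
    qed
  qed
  then have P: "?P n s'" unfolding inputD(1)[OF s(1)] .
  have "?b n e = final_ball s e" if "e < 2 * n" for e
    using balls(2)[of "e - n"] that by (auto simp: final_ball_def)
  then show "input s'" "query_clean s'"
    "if nats s' ''f'' [] = 0 then best_transversal s' \<and> (\<forall>e<2 * n. ball_of s' e = final_ball s e)
     else no_transversal (final_ball s)"
    using P by (auto split: if_splits)
qed

section \<open>The greedy net and the initial transversal\<close>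

lemma net_mark:
  assumes s: "input s" and v: "nats s ''v'' [] = v" "v < n"
  defines "c \<equiv> PFor ''e'' ''n''
         (PIf (RLe (RRead ''d'' [V ''v'', V ''e'']) (RPlus (RRead ''r'' []) (RRead ''r'' [])))
            (PNat ''cov'' [V ''e''] (NConst 1)) PSkip ;;
          PIf (RLe (RRead ''d'' [V ''v'', V ''e'']) (RRead ''r'' []))
            (PNat ''b'' [V ''e''] (V ''v'')) PSkip)"
  assumes j: "j < n"
  shows "ball_of (run \<I> c s) j = (if d v j \<le> reals s ''r'' [] then v else ball_of s j)"
    "nats (run \<I> c s) ''cov'' [j] =
      (if d v j \<le> reals s ''r'' [] + reals s ''r'' [] then 1 else nats s ''cov'' [j])"
proof -
  let ?P = "\<lambda>i s'. same_outside {''e'', ''b'', ''cov''} {} s s' \<and> (\<forall>j<n.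
    ball_of s' j = (if j < i \<and> d v j \<le> reals s ''r'' [] then v else ball_of s j) \<and>
    nats s' ''cov'' [j] = (if j < i \<and> d v j \<le> reals s ''r'' [] + reals s ''r'' [] then 1
      else nats s ''cov'' [j]))"
  have "?P (nats s ''n'' []) (run \<I> c s)"
    unfolding c_def
  proof (rule run_PFor[where P = ?P])
    show "?P 0 (nat_update ''e'' [] 0 s)" by (simp add: same_outside_def ball_of_def)
    fix i and s' :: state assume i: "i < nats s ''n'' []" "nats s' ''e'' [] = i" and P: "?P i s'"
    have fr: "z \<notin> {''e'', ''b'', ''cov''} \<Longrightarrow> nats s' z = nats s z" "reals s' z = reals s z" for z
      using P by (simp_all add: same_outside_def)
    have dv: "reals s ''d'' [v, i] = d v i" using inputD(1,6)[OF s] i v by simp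
    show "?P (Suc i) (nat_update ''e'' [] (Suc i) (run \<I>
        (PIf (RLe (RRead ''d'' [V ''v'', V ''e'']) (RPlus (RRead ''r'' []) (RRead ''r'' [])))
            (PNat ''cov'' [V ''e''] (NConst 1)) PSkip ;;
          PIf (RLe (RRead ''d'' [V ''v'', V ''e'']) (RRead ''r'' []))
            (PNat ''b'' [V ''e''] (V ''v'')) PSkip) s'))"
      using P i v by (auto simp: same_outside_def fr dv less_Suc_eq ball_of_def)
  qed
  then show "ball_of (run \<I> c s) j = (if d v j \<le> reals s ''r'' [] then v else ball_of s j)"
    "nats (run \<I> c s) ''cov'' [j] =
      (if d v j \<le> reals s ''r'' [] + reals s ''r'' [] then 1 else nats s ''cov'' [j])"
    using j inputD(1)[OF s] by auto
qed

text \<open>The state of the greedy construction after \<open>v\<close> points. The equivalence for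
  \<open>ball_of\<close> contains the disjointness of the balls: no point is within \<open>r\<close>
  of two net points.\<close>

definition net_inv :: "real \<Rightarrow> nat \<Rightarrow> state \<Rightarrow> bool" where
  "net_inv r v s \<longleftrightarrow> (\<forall>e<n.
    (ball_of s e < n \<or> ball_of s e = n + 1) \<and>
    (\<forall>u<n. ball_of s e = u \<longleftrightarrow> u < v \<and> nats s ''c'' [u] \<noteq> 0 \<and> d u e \<le> r) \<and>
    (nats s ''cov'' [e] \<noteq> 0 \<longleftrightarrow> (\<exists>u<v. nats s ''c'' [u] \<noteq> 0 \<and> d u e \<le> r + r)) \<and>
    (v \<le> e \<longrightarrow> nats s ''c'' [e] = 0) \<and> (e < v \<longrightarrow> nats s ''cov'' [e] \<noteq> 0))"

lemma net_spec:
  assumes s: "input s" and r: "reals s ''r'' [] = r" "0 \<le> r"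
  shows "net_inv r n (run \<I> net_prog s)"
proof -
  let ?c1 = "PFor ''e'' ''m'' (PNat ''b'' [V ''e''] (V ''l''))"
  let ?c2 = "PFor ''e'' ''n'' (PNat ''c'' [V ''e''] (NConst 0))"
  let ?c3 = "PFor ''e'' ''n'' (PNat ''cov'' [V ''e''] (NConst 0))"
  let ?m = "PFor ''e'' ''n''
         (PIf (RLe (RRead ''d'' [V ''v'', V ''e'']) (RPlus (RRead ''r'' []) (RRead ''r'' [])))
            (PNat ''cov'' [V ''e''] (NConst 1)) PSkip ;;
          PIf (RLe (RRead ''d'' [V ''v'', V ''e'']) (RRead ''r'' []))
            (PNat ''b'' [V ''e''] (V ''v'')) PSkip)"
  let ?c = "PIf (Zero (At ''cov'' (V ''v''))) (PNat ''c'' [V ''v''] (NConst 1) ;; ?m) PSkip"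
  define s1 where "s1 = run \<I> ?c1 s"
  define s2 where "s2 = run \<I> ?c2 s1"
  define s3 where "s3 = run \<I> ?c3 s2"
  have net: "run \<I> net_prog s = run \<I> (PFor ''v'' ''n'' ?c) s3"
    by (simp add: net_prog_def s1_def s2_def s3_def)
  have f1: "nats s1 z = nats s z" if "z \<notin> {''b'', ''e''}" for z
    unfolding s1_def using that by (intro nats_run) auto
  have f2: "nats s2 z = nats s1 z" if "z \<notin> {''c'', ''e''}" for z
    unfolding s2_def using that by (intro nats_run) auto
  have f3: "nats s3 z = nats s2 z" if "z \<notin> {''cov'', ''e''}" for z
    unfolding s3_def using that by (intro nats_run) auto
  have i3: "input s3" unfolding s3_def s2_def s1_def using s by (simp add: input_run)
  have r3: "reals s3 ''r'' [] = r" using r by (simp add: s3_def s2_def s1_def reals_run)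
  have "nats s1 ''b'' = (\<lambda>js. if js \<in> (\<lambda>e. [e]) ` {..<nats s ''m'' []} then n + 1 else nats s ''b'' js)"
    unfolding s1_def
    by (rule run_fill_nat[OF _ inj_single, where f = "\<lambda>_. n + 1"]) (simp_all add: inputD[OF s])
  then have b3: "ball_of s3 e = n + 1" if "e < n" for e
    using that by (simp add: ball_of_def f3 f2 inputD[OF s])
  have "nats s2 ''c'' = (\<lambda>js. if js \<in> (\<lambda>e. [e]) ` {..<nats s1 ''n'' []} then 0 else nats s1 ''c'' js)"
    unfolding s2_def by (rule run_fill_nat[OF _ inj_single, where f = "\<lambda>_. 0"]) simp_all
  then have c3: "nats s3 ''c'' [e] = 0" if "e < n" for e
    using that by (simp add: f3 f1 inputD[OF s])
  have "nats s3 ''cov'' = (\<lambda>js. if js \<in> (\<lambda>e. [e]) ` {..<nats s2 ''n'' []} then 0 else nats s2 ''cov'' js)"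
    unfolding s3_def by (rule run_fill_nat[OF _ inj_single, where f = "\<lambda>_. 0"]) simp_all
  then have cov3: "nats s3 ''cov'' [e] = 0" if "e < n" for e
    using that by (simp add: f2 f1 inputD[OF s])
  have upd: "input (nat_update ''v'' [] i s') = input s'" "net_inv r v (nat_update ''v'' [] i s') = net_inv r v s'"
    for i v s' by (simp_all add: input_update net_inv_def ball_of_def)
  let ?P = "\<lambda>v s'. input s' \<and> reals s' ''r'' [] = r \<and> net_inv r v s'"
  have "?P (nats s3 ''n'' []) (run \<I> (PFor ''v'' ''n'' ?c) s3)"
  proof (rule run_PFor[where P = ?P])
    show "?P 0 (nat_update ''v'' [] 0 s3)"
      using i3 r3 b3 c3 cov3 by (auto simp: upd) (simp add: net_inv_def)
    fix v and s' :: state assume v: "v < nats s3 ''n'' []" "nats s' ''v'' [] = v" and P: "?P v s'"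
    have vn: "v < n" using v(1) inputD(1)[OF i3] by simp
    have inv: "\<And>e. e < n \<Longrightarrow> ball_of s' e < n \<or> ball_of s' e = n + 1"
      "\<And>e u. e < n \<Longrightarrow> u < n \<Longrightarrow> ball_of s' e = u \<longleftrightarrow> u < v \<and> nats s' ''c'' [u] \<noteq> 0 \<and> d u e \<le> r"
      "\<And>e. e < n \<Longrightarrow> nats s' ''cov'' [e] \<noteq> 0 \<longleftrightarrow> (\<exists>u<v. nats s' ''c'' [u] \<noteq> 0 \<and> d u e \<le> r + r)"
      "\<And>e. e < n \<Longrightarrow> v \<le> e \<Longrightarrow> nats s' ''c'' [e] = 0"
      "\<And>e. e < n \<Longrightarrow> e < v \<Longrightarrow> nats s' ''cov'' [e] \<noteq> 0"
      using P unfolding net_inv_def by blast+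
    show "?P (Suc v) (nat_update ''v'' [] (Suc v) (run \<I> ?c s'))"
    proof (cases "nats s' ''cov'' [v] = 0")
      case False
      have "net_inv r (Suc v) s'"
        unfolding net_inv_def
      proof (intro allI impI)
        fix e assume e: "e < n"
        have cv: "nats s' ''c'' [v] = 0" using inv(4) vn by simp
        show "(ball_of s' e < n \<or> ball_of s' e = n + 1) \<and>
          (\<forall>u<n. ball_of s' e = u \<longleftrightarrow> u < Suc v \<and> nats s' ''c'' [u] \<noteq> 0 \<and> d u e \<le> r) \<and>
          (nats s' ''cov'' [e] \<noteq> 0 \<longleftrightarrow> (\<exists>u<Suc v. nats s' ''c'' [u] \<noteq> 0 \<and> d u e \<le> r + r)) \<and>
          (Suc v \<le> e \<longrightarrow> nats s' ''c'' [e] = 0) \<and> (e < Suc v \<longrightarrow> nats s' ''cov'' [e] \<noteq> 0)"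
          using inv[OF e] cv False by (auto simp: less_Suc_eq)
      qed
      then show ?thesis using P False v(2) by (simp add: upd)
    next
      case cov: True
      define t where "t = nat_update ''c'' [v] 1 s'"
      define u where "u = run \<I> ?m t"
      have r': "run \<I> ?c s' = u" using cov v(2) by (simp add: t_def u_def)
      have it: "input t" "nats t ''v'' [] = v" "reals t ''r'' [] = r"
        using P v by (simp_all add: t_def input_update)
      have iu: "input u" "reals u ''r'' [] = r"
        using it by (simp_all add: u_def input_run reals_run)
      have bu: "ball_of u e = (if d v e \<le> r then v else ball_of s' e)" if "e < n" for e
        using net_mark(1)[OF it(1,2) vn that] it(3) by (simp add: u_def t_def ball_of_def)
      have cu: "nats u ''cov'' [e] = (if d v e \<le> r + r then 1 else nats s' ''cov'' [e])" if "e < n" for e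
        using net_mark(2)[OF it(1,2) vn that] it(3) by (simp add: u_def t_def)
      have c: "nats u ''c'' [e] = (if e = v then 1 else nats s' ''c'' [e])" for e
        by (simp add: u_def nats_run t_def)
      \<comment> \<open>If \<open>e\<close> lay in both balls, \<open>v\<close> would be within
        \<open>r + r\<close> of \<open>w\<close> and hence covered. So assigning \<open>e\<close> to
        \<open>v\<close> overwrites no earlier ball.\<close>
      have far: "\<not> d w e \<le> r" if w: "w < v" "nats s' ''c'' [w] \<noteq> 0" and e: "e < n" "d v e \<le> r" for w e
      proof
        assume "d w e \<le> r"
        moreover have "d w v \<le> d w e + d e v" using triangle[of w e v] w e vn by simp
        ultimately have "d w v \<le> r + r" using e commute[of v e] by simp
        then show False using inv(3)[OF vn] w cov by blast
      qed
      have "net_inv r (Suc v) u"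
        unfolding net_inv_def
      proof (intro allI impI conjI)
        fix e assume e: "e < n"
        show "ball_of u e < n \<or> ball_of u e = n + 1" using inv(1)[OF e] vn by (simp add: bu[OF e])
        show "Suc v \<le> e \<Longrightarrow> nats u ''c'' [e] = 0" using inv(4)[OF e] by (simp add: c)
        show "(nats u ''cov'' [e] \<noteq> 0) = (\<exists>u'<Suc v. nats u ''c'' [u'] \<noteq> 0 \<and> d u' e \<le> r + r)"
          using inv(3)[OF e] by (auto simp: cu[OF e] c less_Suc_eq)
        \<comment> \<open>The new net point covers itself, because \<open>r\<close> is
          nonnegative.\<close>
        have "d v v = 0" using vn by simp
        then show "e < Suc v \<Longrightarrow> nats u ''cov'' [e] \<noteq> 0"
          using inv(5)[OF e] r(2) by (auto simp: cu[OF e] less_Suc_eq)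
        fix w assume w: "w < n"
        show "(ball_of u e = w) = (w < Suc v \<and> nats u ''c'' [w] \<noteq> 0 \<and> d w e \<le> r)"
        proof (cases "d v e \<le> r")
          case True
          then show ?thesis using far[of w e] e by (auto simp: bu[OF e] c less_Suc_eq)
        next
          case False
          then show ?thesis using inv(2)[OF e w] by (auto simp: bu[OF e] c less_Suc_eq)
        qed
      qed
      then show ?thesis unfolding r' using iu by (simp add: upd)
    qed
  qed
  then show ?thesis using inputD(1)[OF i3] by (simp add: net)
qed

lemma init_spec:
  assumes s: "input s"
  defines "s' \<equiv> run \<I> init_prog s"
  shows "\<And>e. e < n \<Longrightarrow> ball_of s' e = ball_of s e" "\<And>e. e < n \<Longrightarrow> ball_of s' (n + e) = e"
    "nats s' ''f'' [] = 0" "best_transversal s'"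
proof -
  let ?c1 = "PFor ''e'' ''n'' (PNat ''b'' [NPlus (V ''n'') (V ''e'')] (V ''e''))"
  let ?c2 = "PFor ''e'' ''l'' (PReal ''p'' [V ''e''] (RConst 0))"
  let ?c3 = "PFor ''e'' ''n'' (PNat ''I'' [V ''e''] (NConst 0))"
  let ?c4 = "PFor ''e'' ''n'' (PNat ''I'' [NPlus (V ''n'') (V ''e'')] (NConst 1))"
  define s1 where "s1 = run \<I> ?c1 s"
  define s2 where "s2 = run \<I> ?c2 s1"
  define s3 where "s3 = run \<I> ?c3 s2"
  define s4 where "s4 = run \<I> ?c4 s3"
  have s': "s' = nat_update ''f'' [] 0 s4"
    by (simp add: s'_def init_prog_def s1_def s2_def s3_def s4_def)
  have f1: "nats s1 z = nats s z" if "z \<notin> {''b'', ''e''}" for z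
    unfolding s1_def using that by (intro nats_run) auto
  have f2: "nats s2 z = nats s1 z" if "z \<noteq> ''e''" for z
    unfolding s2_def using that by (intro nats_run) auto
  have f3: "nats s3 z = nats s2 z" if "z \<notin> {''I'', ''e''}" for z
    unfolding s3_def using that by (intro nats_run) auto
  have f4: "nats s4 z = nats s3 z" if "z \<notin> {''I'', ''e''}" for z
    unfolding s4_def using that by (intro nats_run) auto
  note n = inputD(1,3)[OF s]
  have inj: "inj (\<lambda>e. [n + e])" by (auto simp: inj_def)
  have inv: "inv (\<lambda>e. [n + e]) [n + e] = e" for e using inv_f_f[OF inj, of e] .
  have img: "[e] \<in> (\<lambda>e. [n + e]) ` {..<n} \<longleftrightarrow> n \<le> e \<and> e < 2 * n" for e
    by (auto simp: image_iff intro!: bexI[of _ "e - n"])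
  have "nats s1 ''b'' = (\<lambda>js. if js \<in> (\<lambda>e. [n + e]) ` {..<nats s ''n'' []}
      then inv (\<lambda>e. [n + e]) js else nats s ''b'' js)"
    unfolding s1_def
    by (rule run_fill_nat[OF _ inj, where f = "\<lambda>e. e"]) (simp_all add: n)
  then have B: "nats s' ''b'' [e] = (if n \<le> e \<and> e < 2 * n then inv (\<lambda>e. [n + e]) [e] else nats s ''b'' [e])" for e
    by (simp add: s' f4 f3 f2 n img)
  show b1: "ball_of s' e = ball_of s e" if "e < n" for e using that by (simp add: ball_of_def B)
  show b2: "ball_of s' (n + e) = e" if "e < n" for e using that by (simp add: ball_of_def B inv)
  show "nats s' ''f'' [] = 0" by (simp add: s')
  have "nats s3 ''I'' = (\<lambda>js. if js \<in> (\<lambda>e. [e]) ` {..<nats s2 ''n'' []} then 0 else nats s2 ''I'' js)"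
    unfolding s3_def by (rule run_fill_nat[OF _ inj_single, where f = "\<lambda>_. 0"]) simp_all
  moreover have "nats s4 ''I'' = (\<lambda>js. if js \<in> (\<lambda>e. [n + e]) ` {..<nats s3 ''n'' []} then 1 else nats s3 ''I'' js)"
    unfolding s4_def by (rule run_fill_nat[OF _ inj, where f = "\<lambda>_. 1"]) (simp_all add: f3 f2 f1 n)
  ultimately have "nats s' ''I'' [e] = (if n \<le> e then 1 else 0)" if "e < 2 * n" for e
    using that by (auto simp: s' f3 f2 f1 n img)
  then have cur: "current s' = {n..<2 * n}" by (auto simp: current_def split: if_splits)
  have "\<forall>j \<le> n. reals s2 ''p'' [j] = 0"
  proof -
    let ?P = "\<lambda>i s'. \<forall>j<i. reals s' ''p'' [j] = (0::real)"
    have "?P (nats s1 ''l'' []) s2"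
      unfolding s2_def by (rule run_PFor[where P = ?P]) (auto simp: less_Suc_eq)
    then show ?thesis by (simp add: f1 n less_Suc_eq_le)
  qed
  moreover have "reals s' = reals s2" by (auto simp: s' s4_def s3_def reals_run intro!: ext)
  ultimately have p: "price s' e = (if e < n then w e else 0)" if "ball_of s' e < n" for e
    using that by (simp add: price_def)
  have bij: "bij_betw (ball_of s') {n..<2 * n} {..<n}"
    by (rule bij_betw_byWitness[where f' = "\<lambda>e. n + e"])
      (auto simp: b2, (metis b2 le_add_diff_inverse less_diff_conv2 mult_2 add_less_cancel_left)+)
  \<comment> \<open>With all ball prices \<open>0\<close> a dummy costs nothing, and nonnegative
    weights leave no swap that improves on the dummies.\<close>
  have "ext.min_indep (price s') (active (ball_of s')) {n..<2 * n}"
  proof (rule ext.min_indep_local)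
    show "{n..<2 * n} \<in> ext_indep"
    proof -
      have "{n..<2 * n} \<inter> {..<n} = {}" by auto
      then show ?thesis using empty_indep by (auto simp: ext_indep_def)
    qed
    show "{n..<2 * n} \<subseteq> active (ball_of s')" using bij by (auto simp: bij_betw_def)
    fix x y assume x: "x \<in> active (ball_of s') - {n..<2 * n}" and y: "y \<in> {n..<2 * n}"
    have "ball_of s' y < n" using bij y by (auto simp: bij_betw_def)
    then have "price s' y = 0" using p[of y] y by simp
    moreover have "price s' x = w x" "0 \<le> w x" using p[of x] x weight_nonneg by auto
    ultimately show "price s' y \<le> price s' x" by simp
  qed
  then show "best_transversal s'" using bij by (simp add: best_transversal_def cur)
qed

section \<open>From transversals to covers and weights\<close>

definition covers :: "nat set \<Rightarrow> real \<Rightarrow> bool" where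
  "covers A r \<longleftrightarrow> (\<forall>x<n. \<exists>a \<in> A. d x a \<le> r)"

lemma indep_ground: "A \<in> \<I> \<Longrightarrow> a \<in> A \<Longrightarrow> a < n"
  using indep_subset_ground by auto

text \<open>A solution of radius \<open>r\<close> meets the disjoint balls of radius \<open>r\<close> around all net points; the
  dummies stand for the balls of the other points.\<close>

lemma transversal_of_cover:
  assumes net: "net_inv r n s" and A: "A \<in> \<I>" "covers A r"
  shows "\<exists>Z \<in> ext_indep. bij_betw (final_ball s) Z {..<n} \<and> Z \<inter> {..<n} \<subseteq> A"
proof -
  have "\<exists>a. a \<in> A \<and> d v a \<le> r" if "v < n" for v using A(2) that by (auto simp: covers_def)
  then obtain a where a: "\<And>v. v < n \<Longrightarrow> a v \<in> A \<and> d v (a v) \<le> r" by metis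
  define g where "g v = (if nats s ''c'' [v] \<noteq> 0 then a v else n + v)" for v
  have an: "a v < n" if "v < n" for v using a[OF that] indep_ground[OF A(1)] by simp
  have fb: "final_ball s (g v) = v" if v: "v < n" for v
  proof (cases "nats s ''c'' [v] = 0")
    case True
    then show ?thesis by (simp add: g_def final_ball_def)
  next
    case False
    then have "ball_of s (a v) = v"
      using net an[OF v] a[OF v] v unfolding net_inv_def by blast
    then show ?thesis using an[OF v] False by (simp add: g_def final_ball_def)
  qed
  have "bij_betw (final_ball s) (g ` {..<n}) {..<n}"
    by (rule bij_betw_byWitness[where f' = g]) (auto simp: fb)
  moreover have sub: "g ` {..<n} \<inter> {..<n} \<subseteq> A" using a by (auto simp: g_def split: if_splits)
  moreover have "g ` {..<n} \<subseteq> {..<2 * n}" using an by (force simp: g_def)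
  then have "g ` {..<n} \<in> ext_indep" using indep_subset[OF A(1) sub] by (simp add: ext_indep_def)
  ultimately show ?thesis by blast
qed

lemma weight_mono:
  assumes "A \<in> \<I>" "B \<subseteq> A"
  shows "(\<Sum>v\<in>B. w v) \<le> (\<Sum>v\<in>A. w v)"
  using assms indep_ground[OF assms(1)] finite_indep weight_nonneg by (intro sum_mono2) auto

text \<open>Each ball is met exactly once, so the ball prices add up to the same constant for all
  transversals, and comparing prices compares weights.\<close>

lemma sum_price:
  assumes "Z \<subseteq> {..<2 * n}" "bij_betw (ball_of s) Z {..<n}"
  shows "sum (price s) Z = (\<Sum>v \<in> Z \<inter> {..<n}. w v) + (\<Sum>j<n. reals s ''p'' [j])"
proof -
  have fin: "finite Z" using assms(1) finite_subset by blast
  have "(\<Sum>e\<in>Z. reals s ''p'' [ball_of s e]) = (\<Sum>j<n. reals s ''p'' [j])"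
    by (rule sum.reindex_bij_betw[OF assms(2)])
  moreover have "(\<Sum>e\<in>Z. if e < n then w e else 0) = (\<Sum>v \<in> Z \<inter> {..<n}. w v)"
    using fin by (simp add: sum.inter_restrict)
  ultimately show ?thesis by (simp add: price_def sum.distrib)
qed

section \<open>The guarantee for one radius and its bookkeeping\<close>

definition found_set :: "state \<Rightarrow> nat set" where
  "found_set s = {e. e < n \<and> nats s ''I'' [e] \<noteq> 0}"

lemma search_spec:
  assumes s: "input s" "query_clean s" "reals s ''r'' [] = r" "0 \<le> r"
  defines "s' \<equiv> run \<I> (net_prog ;; init_prog ;; transversal_prog) s"
  shows "input s'" "query_clean s'"
    "if nats s' ''f'' [] = 0 then found_set s' \<in> \<I> \<and> covers (found_set s') (3 * r) \<and>
       (\<forall>A \<in> \<I>. covers A r \<longrightarrow> (\<Sum>v\<in>found_set s'. w v) \<le> (\<Sum>v\<in>A. w v))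
     else \<not> (\<exists>A \<in> \<I>. covers A r)"
proof -
  define s1 where "s1 = run \<I> net_prog s"
  define s2 where "s2 = run \<I> init_prog s1"
  have s': "s' = run \<I> transversal_prog s2" by (simp add: s'_def s1_def s2_def)
  have net: "net_inv r n s1" unfolding s1_def using net_spec[OF s(1,3,4)] .
  have i1: "input s1" unfolding s1_def using s(1) by (simp add: input_run)
  have i2: "input s2" unfolding s2_def using i1 by (simp add: input_run)
  have c2: "query_clean s2" using s(2) by (simp add: s2_def s1_def query_clean_def nats_run)
  have b1: "ball_of s1 e < n \<or> ball_of s1 e = n + 1" if "e < n" for e
    using net that by (simp add: net_inv_def)
  note ini = init_spec[OF i1, folded s2_def]
  have b2: "\<forall>e<n. ball_of s2 e < n \<or> ball_of s2 e = n + 1" "\<forall>e<n. ball_of s2 (n + e) = e"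
    using ini(1,2) b1 by auto
  have cc: "nats s2 ''c'' = nats s1 ''c''" by (simp add: s2_def nats_run)
  have fb: "final_ball s2 = final_ball s1" by (simp add: final_ball_def cc ini(1) fun_eq_iff)
  note ts = transversal_spec[OF i2 c2 ini(3) b2 ini(4), folded s', unfolded fb]
  show "input s'" "query_clean s'" by (fact ts(1), fact ts(2))
  show "if nats s' ''f'' [] = 0 then found_set s' \<in> \<I> \<and> covers (found_set s') (3 * r) \<and>
       (\<forall>A \<in> \<I>. covers A r \<longrightarrow> (\<Sum>v\<in>found_set s'. w v) \<le> (\<Sum>v\<in>A. w v))
     else \<not> (\<exists>A \<in> \<I>. covers A r)"
  proof (cases "nats s' ''f'' [] = 0")
    case False
    then show ?thesis using ts(3) transversal_of_cover[OF net] by auto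
  next
    case True
    then have bt: "best_transversal s'" and fin: "\<And>e. e < 2 * n \<Longrightarrow> ball_of s' e = final_ball s1 e"
      using ts(3) by auto
    have mi: "ext.min_indep (price s') (active (ball_of s')) (current s')"
      and bij: "bij_betw (ball_of s') (current s') {..<n}"
      using bt by (auto simp: best_transversal_def)
    have cur: "current s' \<subseteq> {..<2 * n}" by (auto simp: current_def)
    have fs: "found_set s' = current s' \<inter> {..<n}" by (auto simp: found_set_def current_def)
    have "current s' \<in> ext_indep" using mi by (simp add: ext.min_indep_def)
    then have "found_set s' \<in> \<I>" by (simp add: ext_indep_def fs)
    moreover have "covers (found_set s') (3 * r)"
      unfolding covers_def
    proof (intro allI impI)
      fix x assume x: "x < n"
      \<comment> \<open>The factor 3: \<open>x\<close> is within \<open>r + r\<close> of a net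
        point, and the element chosen in the ball of that net point is within \<open>r\<close> of
        it. This element is a real point, since dummies of net points are retired.\<close>
      obtain v where v: "v < n" "nats s1 ''c'' [v] \<noteq> 0" "d v x \<le> r + r"
        using net x unfolding net_inv_def by blast
      have "v \<in> ball_of s' ` current s'" using bij v by (auto simp: bij_betw_def)
      then obtain e where e: "e \<in> current s'" "final_ball s1 e = v" using fin cur by auto
      have en: "e < n" "ball_of s1 e = v"
        using e(2) v(1,2) by (auto simp: final_ball_def split: if_splits)
      then have "d v e \<le> r" using net v(1) unfolding net_inv_def by blast
      moreover have "d x e \<le> d x v + d v e" using triangle[of x v e] x v en by simp
      ultimately have "d x e \<le> 3 * r" using v(3) commute[of x v] by simp
      then show "\<exists>a \<in> found_set s'. d x a \<le> 3 * r" using e(1) en by (auto simp: fs)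
    qed
    moreover have "(\<Sum>v\<in>found_set s'. w v) \<le> (\<Sum>v\<in>A. w v)" if A: "A \<in> \<I>" "covers A r" for A
    proof -
      obtain Z where Z: "Z \<in> ext_indep" "bij_betw (final_ball s1) Z {..<n}" "Z \<inter> {..<n} \<subseteq> A"
        using transversal_of_cover[OF net A] by blast
      have Zs: "Z \<subseteq> {..<2 * n}" using Z(1) ext.indep_subset_ground by blast
      have "bij_betw (ball_of s') Z {..<n} \<longleftrightarrow> bij_betw (final_ball s1) Z {..<n}"
        by (rule bij_betw_cong) (use Zs fin in auto)
      then have Zb: "bij_betw (ball_of s') Z {..<n}" using Z(2) by simp
      have "Z \<subseteq> active (ball_of s')" using Zs Zb by (auto simp: bij_betw_def)
      moreover have "card Z = card (current s')"
        using bij_betw_same_card[OF Zb] bij_betw_same_card[OF bij] by simp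
      ultimately have "sum (price s') (current s') \<le> sum (price s') Z"
        using mi Z(1) by (simp add: ext.min_indep_def)
      then have "(\<Sum>v\<in>found_set s'. w v) \<le> (\<Sum>v \<in> Z \<inter> {..<n}. w v)"
        using sum_price[OF cur bij] sum_price[OF Zs Zb] by (simp add: fs)
      also have "\<dots> \<le> (\<Sum>v\<in>A. w v)" using weight_mono[OF A(1) Z(3)] .
      finally show ?thesis .
    qed
    ultimately show ?thesis using True by simp
  qed
qed

text \<open>Covering forces \<open>A\<close> to be nonempty, as there is at least one point; these
  are thus the feasible sets of radius at most \<open>r\<close>.\<close>

definition solution_within :: "real \<Rightarrow> bool" where
  "solution_within r \<longleftrightarrow> (\<exists>A \<in> \<I>. (\<Sum>v\<in>A. w v) \<le> k \<and> covers A r)"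

text \<open>\<open>best\<close> may be a radius for which no solution exists, since the search can
  succeed there as well. It suffices that \<open>best\<close> is at most every tried radius that
  admits a solution and that the output has radius at most three times \<open>best\<close>.\<close>

definition good_state :: "(nat \<times> nat) set \<Rightarrow> state \<Rightarrow> bool" where
  "good_state Z s \<longleftrightarrow> input s \<and> query_clean s \<and> (\<forall>i\<ge>n. nats s ''S'' [i] = 0) \<and>
    (if nats s ''found'' [] = 0
     then output_set s = {} \<and> (\<forall>(i, j) \<in> Z. \<not> solution_within (d i j))
     else output_set s \<in> \<I> \<and> (\<Sum>v\<in>output_set s. w v) \<le> k \<and>
       covers (output_set s) (3 * reals s ''best'' []) \<and>
       (\<forall>(i, j) \<in> Z. solution_within (d i j) \<longrightarrow> reals s ''best'' [] \<le> d i j))"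

lemma good_state_update:
  assumes "x \<in> {''i'', ''j''}"
  shows "good_state Z (nat_update x is a s) = good_state Z s"
proof -
  have "x \<notin> {''n'', ''m'', ''l''}" "x \<noteq> ''Q''" "x \<noteq> ''S''" "x \<noteq> ''found''" using assms by auto
  then show ?thesis
    by (simp add: good_state_def input_update query_clean_def output_set_def represented_set_def)
qed

lemma weight_loop:
  assumes s: "input s" "reals s ''W'' [] = 0"
  shows "reals (run \<I> (PFor ''e'' ''n'' (PIf (Pos (At ''I'' (V ''e'')))
      (PReal ''W'' [] (RPlus (RRead ''W'' []) (RRead ''w'' [V ''e'']))) PSkip)) s) ''W'' [] =
    (\<Sum>v\<in>found_set s. w v)" (is "reals ?s' _ _ = _")
proof -
  let ?P = "\<lambda>i s'. same_outside {''e''} {''W''} s s' \<and>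
    reals s' ''W'' [] = (\<Sum>v \<in> {v. v < i \<and> nats s ''I'' [v] \<noteq> 0}. w v)"
  have "?P (nats s ''n'' []) ?s'"
  proof (rule run_PFor[where P = ?P])
    show "?P 0 (nat_update ''e'' [] 0 s)" using s(2) by (simp add: same_outside_def)
    fix i and s' :: state assume i: "i < nats s ''n'' []" "nats s' ''e'' [] = i" and P: "?P i s'"
    have fr: "z \<noteq> ''e'' \<Longrightarrow> nats s' z = nats s z" "z \<noteq> ''W'' \<Longrightarrow> reals s' z = reals s z" for z
      using P by (simp_all add: same_outside_def)
    have "{v. v < Suc i \<and> nats s ''I'' [v] \<noteq> 0} = (if nats s ''I'' [i] \<noteq> 0
        then insert i {v. v < i \<and> nats s ''I'' [v] \<noteq> 0} else {v. v < i \<and> nats s ''I'' [v] \<noteq> 0})"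
      by (auto simp: less_Suc_eq)
    moreover have "reals s ''w'' [i] = w i" using inputD(1,4)[OF s(1)] i by simp
    ultimately show "?P (Suc i) (nat_update ''e'' [] (Suc i) (run \<I> (PIf (Pos (At ''I'' (V ''e'')))
      (PReal ''W'' [] (RPlus (RRead ''W'' []) (RRead ''w'' [V ''e'']))) PSkip) s'))"
      using P i by (simp add: same_outside_def fr)
  qed
  then show ?thesis using inputD(1)[OF s(1)] by (simp add: found_set_def)
qed

lemma record_spec:
  assumes s: "input s" "\<forall>i\<ge>n. nats s ''S'' [i] = 0"
  defines "s' \<equiv> run \<I> record_prog s"
  defines "better \<equiv> nats s ''f'' [] = 0 \<and> (\<Sum>v\<in>found_set s. w v) \<le> k \<and>
    (nats s ''found'' [] = 0 \<or> reals s ''r'' [] < reals s ''best'' [])"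
  shows "\<forall>i\<ge>n. nats s' ''S'' [i] = 0"
    "output_set s' = (if better then found_set s else output_set s)"
    "nats s' ''found'' [] = (if better then 1 else nats s ''found'' [])"
    "reals s' ''best'' [] = (if better then reals s ''r'' [] else reals s ''best'' [])"
proof -
  let ?c1 = "PFor ''e'' ''n'' (PIf (Pos (At ''I'' (V ''e'')))
      (PReal ''W'' [] (RPlus (RRead ''W'' []) (RRead ''w'' [V ''e'']))) PSkip)"
  let ?c2 = "PFor ''e'' ''n'' (PNat ''S'' [V ''e''] (At ''I'' (V ''e'')))"
  define s1 where "s1 = run \<I> ?c1 (real_update ''W'' [] 0 s)"
  let ?s2 = "real_update ''best'' [] (reals s ''r'' []) (nat_update ''found'' [] (Suc 0) s1)"
  have f1: "nats s1 z = nats s z" if "z \<noteq> ''e''" for z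
    unfolding s1_def using that by (subst nats_run) auto
  have r1: "reals s1 z = reals s z" if "z \<noteq> ''W''" for z
    unfolding s1_def using that by (subst reals_run) auto
  have "reals s1 ''W'' [] = (\<Sum>v\<in>found_set (real_update ''W'' [] 0 s). w v)"
    unfolding s1_def using s(1) by (intro weight_loop) (simp_all add: input_def)
  then have W: "reals s1 ''W'' [] = (\<Sum>v\<in>found_set s. w v)" by (simp add: found_set_def)
  have s': "s' = (if better then run \<I> ?c2 ?s2 else s1)"
    using inputD(5)[OF s(1)]
    by (auto simp: s'_def record_prog_def better_def W f1 r1 simp flip: s1_def)
  have n2: "nats ?s2 ''n'' [] = n" using inputD(1)[OF s(1)] by (simp add: f1)
  have "nats (run \<I> ?c2 ?s2) ''S'' = (\<lambda>js. if js \<in> (\<lambda>e. [e]) ` {..<nats ?s2 ''n'' []}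
      then nats s ''I'' [inv (\<lambda>e. [e]) js] else nats ?s2 ''S'' js)"
    by (rule run_fill_nat[OF _ inj_single]) (simp_all add: f1)
  then have S: "nats (run \<I> ?c2 ?s2) ''S'' [e] = (if e < n then nats s ''I'' [e] else 0)" for e
    using inv_f_f[OF inj_single, of e] s(2) by (auto simp: n2 f1 inputD(1)[OF s(1)])
  show "\<forall>i\<ge>n. nats s' ''S'' [i] = 0" using s(2) by (simp add: s' S f1)
  show "output_set s' = (if better then found_set s else output_set s)"
    by (auto simp: s' output_set_def represented_set_def S found_set_def f1)
  show "nats s' ''found'' [] = (if better then 1 else nats s ''found'' [])"
    by (simp add: s' nats_run f1)
  show "reals s' ''best'' [] = (if better then reals s ''r'' [] else reals s ''best'' [])"
    by (simp add: s' reals_run r1)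
qed

lemma radius_spec:
  assumes s: "good_state Z s" and ij: "nats s ''i'' [] = i" "nats s ''j'' [] = j" "i < n" "j < n"
  shows "good_state (insert (i, j) Z) (run \<I> radius_prog s)"
proof -
  define s1 where "s1 = real_update ''r'' [] (d i j) s"
  define s2 where "s2 = run \<I> (net_prog ;; init_prog ;; transversal_prog) s1"
  define s3 where "s3 = run \<I> record_prog s2"
  have is0: "input s" "query_clean s" "\<forall>i\<ge>n. nats s ''S'' [i] = 0" using s by (auto simp: good_state_def)
  have run: "run \<I> radius_prog s = s3"
    using ij inputD(6)[OF is0(1)] by (simp add: radius_prog_def s3_def s2_def s1_def)
  have i1: "input s1" "query_clean s1" "reals s1 ''r'' [] = d i j"
    using is0 by (simp_all add: s1_def input_def query_clean_def)
  note sp = search_spec[OF i1 nonneg, folded s2_def]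
  have n2: "nats s2 z = nats s z" if "z \<in> {''S'', ''found''}" for z
  proof -
    have "nats s2 z = nats s1 z" unfolding s2_def using that by (intro nats_run) auto
    then show ?thesis by (simp add: s1_def)
  qed
  have r2: "reals s2 ''r'' [] = d i j" "reals s2 ''best'' = reals s ''best''"
    by (simp_all add: s2_def reals_run s1_def)
  have S2: "\<forall>i\<ge>n. nats s2 ''S'' [i] = 0" using is0(3) n2 by simp
  have o2: "output_set s2 = output_set s" using n2 by (simp add: output_set_def represented_set_def)
  note rec = record_spec[OF sp(1) S2, folded s3_def]
  have i3: "input s3" using sp(1) by (simp add: s3_def input_run)
  have c3: "query_clean s3" using sp(2) by (simp add: s3_def query_clean_def nats_run)
  let ?F = "found_set s2"
  let ?better = "nats s2 ''f'' [] = 0 \<and> (\<Sum>v\<in>?F. w v) \<le> k \<and>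
    (nats s ''found'' [] = 0 \<or> d i j < reals s ''best'' [])"
  have rec': "output_set s3 = (if ?better then ?F else output_set s)"
    "nats s3 ''found'' [] = (if ?better then 1 else nats s ''found'' [])"
    "reals s3 ''best'' [] = (if ?better then d i j else reals s ''best'' [])"
    by (auto simp: rec(2-4) n2 r2 o2)
  show ?thesis
  proof (cases ?better)
    case True
    then have "?F \<in> \<I>" "covers ?F (3 * d i j)" using sp(3) by auto
    \<comment> \<open>Radii tried earlier either admit no solution or are at least the old
      \<open>best\<close>, which was larger than \<open>d i j\<close>.\<close>
    moreover have "\<forall>(i', j') \<in> insert (i, j) Z. solution_within (d i' j') \<longrightarrow> d i j \<le> d i' j'"
      using s True unfolding good_state_def by (cases "nats s ''found'' [] = 0") force+
    moreover have "output_set s3 = ?F" "nats s3 ''found'' [] = 1" "reals s3 ''best'' [] = d i j"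
      using True rec' by auto
    ultimately show ?thesis
      using True i3 c3 rec(1) unfolding run good_state_def by simp
  next
    case False
    \<comment> \<open>If the radius admits a solution, the search succeeds with at most its weight,
      so only an earlier \<open>best\<close> that is no larger can prevent recording.\<close>
    have no: "nats s ''found'' [] \<noteq> 0 \<and> reals s ''best'' [] \<le> d i j" if sol: "solution_within (d i j)"
    proof -
      obtain A where A: "A \<in> \<I>" "(\<Sum>v\<in>A. w v) \<le> k" "covers A (d i j)"
        using sol by (auto simp: solution_within_def)
      then have "nats s2 ''f'' [] = 0" using sp(3) by (auto split: if_splits)
      moreover from this have "(\<Sum>v\<in>?F. w v) \<le> k" using sp(3) A by fastforce
      ultimately show ?thesis using False by auto
    qed
    have eq: "output_set s3 = output_set s" "nats s3 ''found'' [] = nats s ''found'' []"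
      "reals s3 ''best'' [] = reals s ''best'' []"
      using rec' False by (simp_all only: if_False)
    show ?thesis
    proof (cases "nats s ''found'' [] = 0")
      case True
      then show ?thesis using s no i3 c3 rec(1) unfolding run good_state_def eq by auto
    next
      case False
      then show ?thesis using s no i3 c3 rec(1) unfolding run good_state_def eq by auto
    qed
  qed
qed

lemma center_spec:
  assumes s: "good_state {} s"
  shows "good_state ({..<n} \<times> {..<n}) (run \<I> center_prog s)"
proof -
  have n: "good_state Z s' \<Longrightarrow> nats s' ''n'' [] = n" for Z s' by (simp add: good_state_def input_def)
  let ?Z = "\<lambda>i. {..<i} \<times> {..<n}"
  have inner: "good_state (?Z (Suc i)) (run \<I> (PFor ''j'' ''n'' radius_prog) s')"
    if g: "good_state (?Z i) s'" and i: "nats s' ''i'' [] = i" "i < n" for i s'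
  proof -
    let ?P = "\<lambda>j s''. good_state (?Z i \<union> {i} \<times> {..<j}) s'' \<and> nats s'' ''i'' [] = i"
    have "?P (nats s' ''n'' []) (run \<I> (PFor ''j'' ''n'' radius_prog) s')"
    proof (rule run_PFor[where P = ?P])
      show "?P 0 (nat_update ''j'' [] 0 s')" using g i by (simp add: good_state_update)
      fix j s'' assume j: "j < nats s' ''n'' []" "nats s'' ''j'' [] = j" and P: "?P j s''"
      have "good_state (insert (i, j) (?Z i \<union> {i} \<times> {..<j})) (run \<I> radius_prog s'')"
        using P j i n[OF g] by (intro radius_spec) auto
      moreover have "insert (i, j) (?Z i \<union> {i} \<times> {..<j}) = ?Z i \<union> {i} \<times> {..<Suc j}" by auto
      moreover have "nats (run \<I> radius_prog s'') ''i'' = nats s'' ''i''"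
        by (rule nats_run) (simp add: radius_prog_def)
      ultimately show "?P (Suc j) (nat_update ''j'' [] (Suc j) (run \<I> radius_prog s''))"
        using P by (simp add: good_state_update)
    qed
    moreover have "?Z i \<union> {i} \<times> {..<n} = ?Z (Suc i)" by (auto simp: less_Suc_eq)
    ultimately show ?thesis using n[OF g] by simp
  qed
  let ?P = "\<lambda>i s''. good_state (?Z i) s''"
  have "?P (nats s ''n'' []) (run \<I> center_prog s)"
    unfolding center_prog_def
  proof (rule run_PFor[where P = ?P])
    show "?P 0 (nat_update ''i'' [] 0 s)" using s by (simp add: good_state_update)
    fix i s'' assume "i < nats s ''n'' []" "nats s'' ''i'' [] = i" "?P i s''"
    then have "good_state (?Z (Suc i)) (run \<I> (PFor ''j'' ''n'' radius_prog) s'')"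
      using n[OF s] by (intro inner) auto
    then show "?P (Suc i) (nat_update ''i'' [] (Suc i) (run \<I> (PFor ''j'' ''n'' radius_prog) s''))"
      by (simp add: good_state_update)
  qed
  then show ?thesis using n[OF s] by simp
qed

section \<open>The objective value and the final guarantee\<close>

lemma n_pos: "0 < n"
  using nonempty by auto

lemma center_cost_le:
  assumes "A \<in> \<I>" "covers A r"
  shows "center_cost {..<n} d A \<le> r"
proof -
  have fin: "finite A" using assms(1) finite_indep by blast
  have "set_distance d v A \<le> r" if "v < n" for v
  proof -
    obtain a where "a \<in> A" "d v a \<le> r" using assms(2) \<open>v < n\<close> by (auto simp: covers_def)
    moreover from this have "set_distance d v A \<le> d v a"
      unfolding set_distance_def using fin by (intro Min_le) auto
    ultimately show ?thesis by simp
  qed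
  then show ?thesis unfolding center_cost_def using n_pos by (intro Max.boundedI) auto
qed

text \<open>Minimum and maximum over finite nonempty sets are attained, so the optimum is among the
  distances tried.\<close>

lemma center_cost_attained:
  assumes "A \<in> \<I>" "A \<noteq> {}"
  shows "\<exists>i<n. \<exists>j<n. center_cost {..<n} d A = d i j \<and> covers A (d i j)"
proof -
  have fin: "finite A" using assms(1) finite_indep by blast
  have sd: "\<exists>a \<in> A. set_distance d v A = d v a" for v
  proof -
    have "set_distance d v A \<in> (\<lambda>u. d v u) ` A"
      unfolding set_distance_def using fin assms(2) by (intro Min_in) auto
    then show ?thesis by blast
  qed
  have "center_cost {..<n} d A \<in> (\<lambda>v. set_distance d v A) ` {..<n}"
    unfolding center_cost_def using n_pos by (intro Max_in) auto
  then obtain i where i: "i < n" "center_cost {..<n} d A = set_distance d i A" by auto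
  obtain j where j: "j \<in> A" "set_distance d i A = d i j" using sd by blast
  have "\<exists>a \<in> A. d x a \<le> d i j" if "x < n" for x
  proof -
    have "set_distance d x A \<le> center_cost {..<n} d A"
      unfolding center_cost_def using that by (intro Max_ge) auto
    then show ?thesis using sd[of x] i j by auto
  qed
  then show ?thesis using i j indep_ground[OF assms(1)] by (auto simp: covers_def)
qed

lemma good_state_output:
  assumes g: "good_state ({..<n} \<times> {..<n}) s"
  shows "if \<exists>S. feasible \<I> w k S
    then feasible \<I> w k (output_set s) \<and>
      center_cost {..<n} d (output_set s) \<le> 3 * opt_cost {..<n} d \<I> w k
    else output_set s = {}"
proof (cases "\<exists>S. feasible \<I> w k S")
  case True
  let ?C = "center_cost {..<n} d ` {S. feasible \<I> w k S}"
  have "{S. feasible \<I> w k S} \<subseteq> Pow {..<n}"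
    using indep_subset_ground by (auto simp: feasible_def)
  then have "finite {S. feasible \<I> w k S}" by (rule finite_subset) simp
  then have "opt_cost {..<n} d \<I> w k \<in> ?C"
    unfolding opt_cost_def using True by (intro Min_in) auto
  then obtain A where A: "feasible \<I> w k A" "opt_cost {..<n} d \<I> w k = center_cost {..<n} d A" by auto
  then obtain i j where ij: "i < n" "j < n" "center_cost {..<n} d A = d i j" "covers A (d i j)"
    using center_cost_attained[of A] by (auto simp: feasible_def)
  then have "solution_within (d i j)" using A(1) by (auto simp: solution_within_def feasible_def)
  have f: "nats s ''found'' [] \<noteq> 0"
  proof
    assume "nats s ''found'' [] = 0"
    then have "\<forall>(i, j) \<in> {..<n} \<times> {..<n}. \<not> solution_within (d i j)" using g by (simp add: good_state_def)
    then show False using ij(1,2) \<open>solution_within (d i j)\<close> by auto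
  qed
  then have o: "output_set s \<in> \<I>" "(\<Sum>v\<in>output_set s. w v) \<le> k"
    "covers (output_set s) (3 * reals s ''best'' [])" "reals s ''best'' [] \<le> d i j"
    using g ij(1,2) \<open>solution_within (d i j)\<close> by (auto simp: good_state_def)
  have "output_set s \<noteq> {}" using o(3) n_pos by (auto simp: covers_def)
  then show ?thesis using True o center_cost_le[OF o(1,3)] A(2) ij(3) by (simp add: feasible_def)
next
  case False
  have "output_set s = {}"
  proof (rule ccontr)
    assume "output_set s \<noteq> {}"
    moreover from this have "nats s ''found'' [] \<noteq> 0" using g by (auto simp: good_state_def)
    ultimately show False using g False by (auto simp: good_state_def feasible_def)
  qed
  then show ?thesis using False by simp
qed

text \<open>The loop bounds \<open>n\<close>, \<open>2 * n\<close> and \<open>n + 1\<close> are all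
  at most \<open>2 * n + 1\<close>, hence the substitution of \<open>[:1, 2:]\<close>. The summand 2
  pays for the assignments to \<open>m\<close> and \<open>l\<close>.\<close>

lemma center_algorithm_exec:
  "\<exists>t s. exec \<I> center_algorithm (input_state n d w k) t s \<and>
    t \<le> poly (pcompose (cost center_prog) [:1, 2:] + 2) n \<and> good_state ({..<n} \<times> {..<n}) s"
proof -
  let ?s = "input_state n d w k"
  let ?s1 = "nat_update ''m'' [] (2 * n) ?s"
  let ?s2 = "nat_update ''l'' [] (n + 1) ?s1"
  have "exec \<I> (NAssign ''m'' [] (NPlus (V ''n'') (V ''n''))) ?s 1 ?s1"
    using exec.NAssign[of \<I> "''m''" "[]" "NPlus (V ''n'') (V ''n'')" ?s]
    by (simp add: input_state_def mult_2)
  moreover have "exec \<I> (NAssign ''l'' [] (NPlus (V ''n'') (NConst 1))) ?s1 1 ?s2"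
    using exec.NAssign[of \<I> "''l''" "[]" "NPlus (V ''n'') (NConst 1)" ?s1]
    by (simp add: input_state_def)
  moreover have "\<exists>t \<le> poly (cost center_prog) (2 * n + 1).
      exec \<I> (compile center_prog) ?s2 t (run \<I> center_prog ?s2)"
    using center_prog_wf by (intro exec_compile) (auto simp: input_state_def)
  then obtain t where "t \<le> poly (cost center_prog) (2 * n + 1)"
    "exec \<I> (compile center_prog) ?s2 t (run \<I> center_prog ?s2)" by blast
  ultimately have "exec \<I> center_algorithm ?s (1 + (1 + t)) (run \<I> center_prog ?s2)"
    unfolding center_algorithm_def by (intro exec.Seq)
  moreover have "1 + (1 + t) \<le> poly (pcompose (cost center_prog) [:1, 2:] + 2) n"
    using \<open>t \<le> _\<close> by (simp add: poly_pcompose mult.commute)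
  moreover have "good_state {} ?s2"
    by (simp add: good_state_def input_def query_clean_def output_set_def represented_set_def input_state_def)
  then have "good_state ({..<n} \<times> {..<n}) (run \<I> center_prog ?s2)" by (rule center_spec)
  ultimately show ?thesis by blast
qed

end

theorem theorem8:
  shows "\<exists>A. polynomial_time A \<and> approximation_algorithm 3 A"
proof (intro exI conjI)
  \<comment> \<open>The polynomial does not depend on the instance, and one execution yields both
    the time bound and the guarantee.\<close>
  have exec: "\<exists>t s. exec \<I> center_algorithm (input_state n d w k) t s \<and>
      t \<le> poly (pcompose (cost center_prog) [:1, 2:] + 2) n \<and>
      (if \<exists>S. feasible \<I> w k S
       then feasible \<I> w k (output_set s) \<and>
         center_cost {..<n} d (output_set s) \<le> 3 * opt_cost {..<n} d \<I> w k
       else output_set s = {})"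
    if "knapsack_matroid_instance {..<n} d \<I> w" for n d \<I> w k
  proof -
    interpret center_instance n d \<I> w k using that by (simp add: center_instance_def)
    show ?thesis using center_algorithm_exec good_state_output by blast
  qed
  show "polynomial_time center_algorithm"
    unfolding polynomial_time_def using exec by blast
  show "approximation_algorithm 3 center_algorithm"
    unfolding approximation_algorithm_def using exec by blast
qed

end
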